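(* Let $n\in\mathbb{N}$, let $\mathcal{C}$ be a submonoid of $\mathbb{N}_0^n(+)$, and let $S$ be a semiring that is a factor (homomorphic image) of the monoid semiring $\mathbb{N}[\mathcal{C}]$. Then: (i) The semigroup $S(+)$ is almost-divisible if and only if $S(+)$ is torsion. (ii) The semigroup $S(+)$ is strongly almost-divisible if and only if $S(+)$ is both regular and torsion. (iii) The semiring $S$ cannot contain (a copy of) the semiring $\mathbb{N}_P$ as a subsemiring for any infinite set $P$ of prime numbers.
   Context: $\mathbb{N}$ is the set of positive integers; $\mathbb{N}_0^n$ is the set of $n$-tuples of non-negative integers. A semiring $S(+,\cdot)$ is a non-empty set with two operations such that $S(+)$ is a commutative semigroup, $S(\cdot)$ is a semigroup and multiplication distributes over addition (no zero or unity is required, and subsemirings need not share the unity). For $\alpha=(a_1,\dots,a_n)\in\mathbb{N}_0^n$ put $\boldsymbol{x}^\alpha=x_1^{a_1}\cdots x_n^{a_n}$. For a submonoid $\mathcal{C}$ of $\mathbb{N}_0^n(+)$, $\mathbb{N}[\mathcal{C}]=\{\sum_{i=1}^m k_i\boldsymbol{x}^{\alpha_i}\mid m\in\mathbb{N},\ k_i\in\mathbb{N},\ \alpha_i\in\mathcal{C}\}$, a subsemiring of $\mathbb{Z}[x_1,\dots,x_n]$. A factor of a semiring is a homomorphic image of it. An element $a$ of a semigroup $A(+)$ is: torsion if $\{\ell a\mid \ell\in\mathbb{N}\}$ is finite; regular if there is $b\in A$ with $a=a+b+a$; strongly almost-divisible if there is an infinite set $P$ of prime numbers such that for every $p\in P$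 there is $c\in A$ with $a=pc$; almost-divisible if there is $k\in\mathbb{N}$ such that $ka$ is strongly almost-divisible. The semigroup $A$ has one of these properties if every element of $A$ has it. For a non-empty set $P$ of prime numbers, $\mathbb{N}_P=\{\frac{k}{q}\mid k\in\mathbb{N},\ q\text{ is a product of primes from }P\}$ (repetitions allowed), a subsemiring of the positive rationals $\mathbb{Q}^+$. *)

theory Defs
  imports
    Complex_Main
    "HOL-Library.Poly_Mapping"
    "HOL-Library.Multiset"
    "HOL-Computational_Algebra.Primes"
begin

text \<open>
  A semiring (no zero or unity required) is a type of class \<^class>\<open>semiring\<close>; its additive
  reduct is of class \<^class>\<open>ab_semigroup_add\<close>.
\<close>

text \<open>
  The multiple \<open>a + \<dots> + a\<close> with \<open>l\<close> summands. A semigroup need not have a zero, so this is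
  meaningful for \<open>l \<ge> 1\<close> only (\<open>l = 0\<close> gives the junk value \<open>a\<close>).
\<close>

definition multiple :: "nat \<Rightarrow> 'a::semigroup_add \<Rightarrow> 'a" where
  "multiple l a = ((+) a ^^ (l - 1)) a"

lemma multiple_1 [simp]: "multiple (Suc 0) a = a"
  by (simp add: multiple_def)

lemma multiple_Suc: "l \<ge> 1 \<Longrightarrow> multiple (Suc l) a = a + multiple l a"
  by (cases l) (simp_all add: multiple_def)

lemma multiple_eq_of_nat_mult:
  fixes a :: "'a::semiring_1"
  assumes "l \<ge> 1"
  shows "multiple l a = of_nat l * a"
  using assms by (induction l rule: dec_induct) (simp_all add: multiple_Suc distrib_right)

definition torsion :: "'a::semigroup_add \<Rightarrow> bool" where
  "torsion a \<longleftrightarrow> finite {multiple l a | l. l \<ge> 1}"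

definition regular :: "'a::semigroup_add \<Rightarrow> bool" where
  "regular a \<longleftrightarrow> (\<exists>b. a = a + b + a)"

definition strongly_almost_divisible :: "'a::semigroup_add \<Rightarrow> bool" where
  "strongly_almost_divisible a \<longleftrightarrow>
     (\<exists>P :: nat set. infinite P \<and> (\<forall>p\<in>P. prime p) \<and> (\<forall>p\<in>P. \<exists>c. a = multiple p c))"

definition almost_divisible :: "'a::semigroup_add \<Rightarrow> bool" where
  "almost_divisible a \<longleftrightarrow> (\<exists>k\<ge>1. strongly_almost_divisible (multiple k a))"

text \<open>
  The variables are indexed by \<open>{1..n}\<close>; an exponent tuple in \<open>\<nat>\<^sub>0\<^sup>n\<close> is a finitely supported
  function \<^typ>\<open>nat \<Rightarrow>\<^sub>0 nat\<close> with support in \<open>{1..n}\<close>.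
\<close>

definition exponents :: "nat \<Rightarrow> (nat \<Rightarrow>\<^sub>0 nat) set" where
  "exponents n = {\<alpha>. Poly_Mapping.keys \<alpha> \<subseteq> {1..n}}"

definition submonoid_of_exponents :: "nat \<Rightarrow> (nat \<Rightarrow>\<^sub>0 nat) set \<Rightarrow> bool" where
  "submonoid_of_exponents n C \<longleftrightarrow>
     C \<subseteq> exponents n \<and> 0 \<in> C \<and> (\<forall>\<alpha>\<in>C. \<forall>\<beta>\<in>C. \<alpha> + \<beta> \<in> C)"

text \<open>
  Integer polynomials are elements of the convolution ring \<^typ>\<open>(nat \<Rightarrow>\<^sub>0 nat) \<Rightarrow>\<^sub>0 int\<close>, where
  \<open>Poly_Mapping.single \<alpha> k\<close> is the monomial \<open>k x\<^sup>\<alpha>\<close>. As \<open>m\<close> and all \<open>k i\<close> are positive,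
  the zero polynomial does not belong to the monoid semiring.
\<close>

definition monoid_semiring :: "(nat \<Rightarrow>\<^sub>0 nat) set \<Rightarrow> ((nat \<Rightarrow>\<^sub>0 nat) \<Rightarrow>\<^sub>0 int) set" where
  "monoid_semiring C =
     {\<Sum>i=1..m. Poly_Mapping.single (\<alpha> i) (int (k i)) | (m :: nat) k \<alpha>.
        m \<ge> 1 \<and> (\<forall>i\<in>{1..m}. k i \<ge> 1 \<and> \<alpha> i \<in> C)}"

definition semiring_hom_on :: "'a::semiring set \<Rightarrow> ('a \<Rightarrow> 'b::semiring) \<Rightarrow> bool" where
  "semiring_hom_on A f \<longleftrightarrow>
     (\<forall>x\<in>A. \<forall>y\<in>A. f (x + y) = f x + f y \<and> f (x * y) = f x * f y)"

definition fractions :: "nat set \<Rightarrow> rat set" where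
  "fractions P = {of_nat k / of_nat (prod_mset Q) | k Q. k \<ge> 1 \<and> set_mset Q \<subseteq> P}"

end

theory Submission
  imports
    Defs
    "HOL-Computational_Algebra.Polynomial"
    "HOL-Library.Function_Algebras"
    "HOL-Number_Theory.Cong"
begin

text \<open>
  Suppose that \<open>1\<close>, or a multiple \<open>k\<close> of it, is divisible in the image of \<open>\<nat>[C]\<close> by all primes of
  an infinite set. Every monomial occurring in a quotient \<open>k / p\<close> lies below a multiple of \<open>1\<close>, and
  the exponents of such monomials form a submonoid \<open>B\<close> of \<open>C\<close>. In the difference ring of the image of
  \<open>\<nat>[B]\<close> some positive integer must vanish: otherwise there is a prime ideal of \<open>\<int>[B]\<close> above the
  kernel without positive integers; the monomials outside it generate a finitely generated group, so
  infinitely many primes divide powers of \<open>k\<close> times a monomial in a finitely generated domain of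
  characteristic zero, whereas eliminating the generators one at a time leaves only the prime divisors
  of one nonzero integer. Thus \<open>m + s = s\<close> for some \<open>m \<ge> 1\<close> and some \<open>s\<close> in the image of \<open>\<nat>[B]\<close>, and as
  \<open>s\<close> lies below a multiple of \<open>1\<close>, also \<open>m + l = l\<close> for some \<open>l \<ge> 1\<close>. Then \<open>m a + l a = l a\<close> for
  every \<open>a\<close>, which is torsion with a uniform period. For (iii), the same is applied to the ideal \<open>S e\<close>,
  whose unity \<open>e\<close> is the image of \<open>1 \<in> \<nat>\<^sub>P\<close>.
\<close>

section \<open>Divisibility in finitely generated extensions modulo a prime ideal\<close>

definition is_subring :: "'r::comm_ring_1 set \<Rightarrow> bool" where
  "is_subring A \<longleftrightarrow> 1 \<in> A \<and> (\<forall>x\<in>A. \<forall>y\<in>A. x - y \<in> A \<and> x * y \<in> A)"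

definition is_ideal_of :: "'r::comm_ring_1 set \<Rightarrow> 'r set \<Rightarrow> bool" where
  "is_ideal_of I D \<longleftrightarrow> I \<subseteq> D \<and> 0 \<in> I \<and> (\<forall>x\<in>I. \<forall>y\<in>I. x + y \<in> I) \<and> (\<forall>x\<in>D. \<forall>y\<in>I. x * y \<in> I)"

definition poly_over :: "'r::comm_ring_1 set \<Rightarrow> 'r poly set" where
  "poly_over A = {q. \<forall>i. coeff q i \<in> A}"

definition adjoin :: "'r::comm_ring_1 set \<Rightarrow> 'r \<Rightarrow> 'r set" where
  "adjoin A x = (\<lambda>q. poly q x) ` poly_over A"

lemma subring_1: "is_subring A \<Longrightarrow> 1 \<in> A"
  and subring_diff: "is_subring A \<Longrightarrow> x \<in> A \<Longrightarrow> y \<in> A \<Longrightarrow> x - y \<in> A"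
  and subring_mult: "is_subring A \<Longrightarrow> x \<in> A \<Longrightarrow> y \<in> A \<Longrightarrow> x * y \<in> A"
  by (auto simp: is_subring_def)

lemma subring_0: "is_subring A \<Longrightarrow> 0 \<in> A"
  using subring_diff[of A 1 1] subring_1[of A] by simp

lemma subring_uminus: "is_subring A \<Longrightarrow> x \<in> A \<Longrightarrow> - x \<in> A"
  using subring_diff[of A 0 x] subring_0[of A] by simp

lemma subring_add: "is_subring A \<Longrightarrow> x \<in> A \<Longrightarrow> y \<in> A \<Longrightarrow> x + y \<in> A"
  using subring_diff[of A x "- y"] subring_uminus[of A y] by simp

lemma subring_power: "is_subring A \<Longrightarrow> x \<in> A \<Longrightarrow> x ^ j \<in> A"
  by (induction j) (auto intro: subring_1 subring_mult)

lemma subring_sum: "is_subring A \<Longrightarrow> (\<And>i. i \<in> K \<Longrightarrow> h i \<in> A) \<Longrightarrow> sum h K \<in> A"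
  by (induction K rule: infinite_finite_induct) (auto intro: subring_0 subring_add)

lemma subring_of_nat: "is_subring A \<Longrightarrow> of_nat k \<in> A"
  by (induction k) (auto intro: subring_0 subring_1 subring_add)

lemmas subring_intros = subring_0 subring_1 subring_add subring_diff subring_uminus subring_mult
  subring_power subring_sum subring_of_nat

lemma poly_over_subring: "is_subring A \<Longrightarrow> is_subring (poly_over A)"
  unfolding is_subring_def[of "poly_over A"]
  by (auto simp: poly_over_def coeff_mult coeff_1 intro!: subring_intros)

lemma poly_over_const: "is_subring A \<Longrightarrow> a \<in> A \<Longrightarrow> [:a:] \<in> poly_over A"
  by (auto simp: poly_over_def coeff_pCons intro: subring_0 split: nat.split)

lemma poly_over_monom: "is_subring A \<Longrightarrow> a \<in> A \<Longrightarrow> monom a i \<in> poly_over A"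
  by (auto simp: poly_over_def intro: subring_0)

lemma poly_over_smult: "is_subring A \<Longrightarrow> a \<in> A \<Longrightarrow> q \<in> poly_over A \<Longrightarrow> smult a q \<in> poly_over A"
  by (auto simp: poly_over_def intro: subring_mult)

lemma adjoin_subring:
  assumes "is_subring A"
  shows "is_subring (adjoin A x)"
proof -
  have "1 \<in> adjoin A x"
    using subring_1[OF poly_over_subring[OF assms]]
    unfolding adjoin_def by (intro image_eqI[of _ _ 1]) auto
  moreover have "poly p x - poly q x \<in> adjoin A x" "poly p x * poly q x \<in> adjoin A x"
    if "p \<in> poly_over A" "q \<in> poly_over A" for p q
    using subring_diff[OF poly_over_subring[OF assms] that]
      subring_mult[OF poly_over_subring[OF assms] that]
    unfolding adjoin_def by (simp_all flip: poly_diff poly_mult)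
  ultimately show ?thesis
    by (auto simp: is_subring_def adjoin_def)
qed

lemma adjoin_superset: "is_subring A \<Longrightarrow> A \<subseteq> adjoin A x"
  unfolding adjoin_def using poly_over_const by (force intro: image_eqI[of _ _ "[:_:]"])

lemma adjoin_generator: "is_subring A \<Longrightarrow> x \<in> adjoin A x"
  unfolding adjoin_def
  by (rule image_eqI[of _ _ "monom 1 1"]) (auto simp: poly_monom intro: poly_over_monom subring_1)

lemma poly_in_subring: "is_subring D \<Longrightarrow> q \<in> poly_over D \<Longrightarrow> x \<in> D \<Longrightarrow> poly q x \<in> D"
  by (auto simp: poly_altdef poly_over_def intro!: subring_intros)

lemma poly_over_mono: "A \<subseteq> D \<Longrightarrow> poly_over A \<subseteq> poly_over D"
  by (auto simp: poly_over_def)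

lemma adjoin_subset: "is_subring D \<Longrightarrow> A \<subseteq> D \<Longrightarrow> x \<in> D \<Longrightarrow> adjoin A x \<subseteq> D"
  unfolding adjoin_def using poly_in_subring poly_over_mono by blast

text \<open>The leading coefficient of \<open>h\<close> need not be invertible, so each cancellation
  of a leading term multiplies \<open>g\<close> by it once more. The alternative
  \<open>r = 0\<close> covers constant \<open>h\<close>. The bound on \<open>degree w\<close> is
  what later allows a quotient to be compared with a polynomial of minimal degree.\<close>

lemma pseudo_division:
  assumes A: "is_subring A" and h: "h \<in> poly_over A" and g: "g \<in> poly_over A"
  shows "\<exists>s w r. w \<in> poly_over A \<and> r \<in> poly_over A \<and>
    smult (lead_coeff h ^ s) g = h * w + r \<and> (degree r < degree h \<or> r = 0) \<and>
    degree w \<le> degree g - degree h"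
  using g
proof (induction "degree g" arbitrary: g rule: less_induct)
  case (less g)
  note P = poly_over_subring[OF A]
  define c where "c = lead_coeff h"
  have c: "c \<in> A" and lg: "lead_coeff g \<in> A"
    using h less.prems by (auto simp: c_def poly_over_def)
  show ?case
  proof (cases "degree g < degree h \<or> g = 0")
    case True
    then show ?thesis
      using less.prems P by (intro exI[of _ 0] exI[of _ g]) (auto intro: subring_0)
  next
    case False
    define d where "d = degree g - degree h"
    define g' where "g' = smult c g - h * monom (lead_coeff g) d"
    have M: "monom (lead_coeff g) d \<in> poly_over A"
      by (rule poly_over_monom[OF A lg])
    have g'A: "g' \<in> poly_over A"
      unfolding g'_def by (intro subring_diff[OF P] subring_mult[OF P] h M poly_over_smult A c less.prems)
    have dg: "degree g = degree h + d" using False by (simp add: d_def)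
    have "degree g' \<le> degree g" unfolding g'_def
    proof (rule degree_diff_le)
      show "degree (smult c g) \<le> degree g" by (rule degree_smult_le)
      show "degree (h * monom (lead_coeff g) d) \<le> degree g"
        using degree_mult_le[of h "monom (lead_coeff g) d"] degree_monom_le[of "lead_coeff g" d] dg by linarith
    qed
    moreover have "coeff g' (degree g) = 0"
      unfolding g'_def mult.commute[of h] by (simp add: coeff_monom_mult dg c_def)
    ultimately have small: "degree g' < degree g \<or> g' = 0"
      by (metis leading_coeff_0_iff le_neq_implies_less)
    show ?thesis
    proof (cases "g' = 0")
      case True
      then have "smult (c ^ 1) g = h * monom (lead_coeff g) d + 0" by (simp add: g'_def)
      then show ?thesis
        using M degree_monom_le[of "lead_coeff g" d] subring_0[OF P] unfolding d_def c_def by blast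
    next
      case nz: False
      with small have "degree g' < degree g" by simp
      from less.hyps[OF this g'A] obtain s w r where w: "w \<in> poly_over A" "r \<in> poly_over A"
        "smult (c ^ s) g' = h * w + r" "degree r < degree h \<or> r = 0" "degree w \<le> degree g' - degree h"
        unfolding c_def by blast
      define w' where "w' = w + smult (c ^ s) (monom (lead_coeff g) d)"
      have "smult (c ^ Suc s) g = h * w' + r"
      proof -
        have "smult (c ^ Suc s) g = smult (c ^ s) (g' + h * monom (lead_coeff g) d)"
          by (simp add: g'_def mult.commute)
        also have "\<dots> = h * w' + r"
          by (simp add: smult_add_right w w'_def algebra_simps)
        finally show ?thesis .
      qed
      moreover have "w' \<in> poly_over A"
        unfolding w'_def by (intro subring_add[OF P] w poly_over_smult A M subring_power c)
      moreover have "degree w' \<le> degree g - degree h"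
        unfolding w'_def
      proof (rule degree_add_le)
        show "degree w \<le> degree g - degree h" using w(5) \<open>degree g' < degree g\<close> by linarith
        show "degree (smult (c ^ s) (monom (lead_coeff g) d)) \<le> degree g - degree h"
          using degree_smult_le degree_monom_le unfolding d_def by (meson order_trans)
      qed
      ultimately show ?thesis
        using w unfolding c_def by blast
    qed
  qed
qed

text \<open>Zero divisors may make \<open>degree (q ^ j)\<close> smaller than
  \<open>j * degree q\<close>. Then both the coefficient of the next power and the coefficient it is
  compared with are zero, so the formula survives.\<close>

lemma coeff_power_times_degree:
  fixes q :: "'r::comm_ring_1 poly"
  shows "coeff (q ^ j) (j * degree q) = lead_coeff q ^ j"
proof (induction j)
  case (Suc j)
  have "coeff (q * q ^ j) (degree q + j * degree q) = lead_coeff q * coeff (q ^ j) (j * degree q)"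
  proof (cases "degree (q ^ j) = j * degree q")
    case True
    then show ?thesis using coeff_mult_degree_sum[of q "q ^ j"] by simp
  next
    case False
    then have "degree (q ^ j) < j * degree q" using degree_power_le[of q j] by (simp add: mult.commute)
    moreover from this have "degree (q * q ^ j) < degree q + j * degree q"
      using degree_mult_le[of q "q ^ j"] by linarith
    ultimately show ?thesis by (simp add: coeff_eq_0)
  qed
  then show ?case by (simp add: Suc)
qed simp

section \<open>Congruence modulo a prime ideal of a subring\<close>

locale prime_in_subring =
  fixes D Q :: "'r::comm_ring_1 set"
  assumes D: "is_subring D" and Q: "is_ideal_of Q D" and one_notin: "1 \<notin> Q"
    and prime: "\<And>x y. x \<in> D \<Longrightarrow> y \<in> D \<Longrightarrow> x * y \<in> Q \<Longrightarrow> x \<in> Q \<or> y \<in> Q"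
begin

lemma Q_0: "0 \<in> Q"
  and Q_add: "x \<in> Q \<Longrightarrow> y \<in> Q \<Longrightarrow> x + y \<in> Q"
  and Q_mult: "x \<in> D \<Longrightarrow> y \<in> Q \<Longrightarrow> x * y \<in> Q"
  using Q by (auto simp: is_ideal_of_def)

lemma Q_mult2: "y \<in> Q \<Longrightarrow> x \<in> D \<Longrightarrow> y * x \<in> Q"
  using Q_mult[of x y] by (simp add: mult.commute)

lemma Q_uminus: "x \<in> Q \<Longrightarrow> - x \<in> Q"
  using Q_mult[of "- 1" x] D by (simp add: subring_intros)

lemma Q_diff: "x \<in> Q \<Longrightarrow> y \<in> Q \<Longrightarrow> x - y \<in> Q"
  using Q_add[of x "- y"] Q_uminus[of y] by simp

lemma Q_sum: "(\<And>i. i \<in> K \<Longrightarrow> h i \<in> Q) \<Longrightarrow> sum h K \<in> Q"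
  by (induction K rule: infinite_finite_induct) (auto intro: Q_0 Q_add)

text \<open>This is equality in the domain D/Q, kept as a congruence so that no quotient type has to
  be formed.\<close>

definition eqv :: "'r \<Rightarrow> 'r \<Rightarrow> bool" (infix \<open>\<approx>\<close> 50) where
  "x \<approx> y \<longleftrightarrow> x - y \<in> Q"

lemma eqv_refl [simp]: "x \<approx> x"
  by (simp add: eqv_def Q_0)

lemma eqv_sym: "x \<approx> y \<Longrightarrow> y \<approx> x"
  using Q_uminus[of "x - y"] by (simp add: eqv_def)

lemma eqv_trans [trans]: "x \<approx> y \<Longrightarrow> y \<approx> z \<Longrightarrow> x \<approx> z"
  using Q_add[of "x - y" "y - z"] by (simp add: eqv_def)

lemma eqv_in_Q: "x \<approx> y \<Longrightarrow> x \<in> Q \<longleftrightarrow> y \<in> Q"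
  using Q_add[of "x - y" y] Q_diff[of x "x - y"] by (auto simp: eqv_def)

lemma eqv_0: "x \<approx> 0 \<longleftrightarrow> x \<in> Q"
  by (simp add: eqv_def)

lemma eqv_mult:
  assumes "x \<approx> x'" "y \<approx> y'" "x' \<in> D" "y \<in> D"
  shows "x * y \<approx> x' * y'"
proof -
  have "x * y - x' * y' = y * (x - x') + x' * (y - y')" by (simp add: algebra_simps)
  then show ?thesis using assms by (simp add: eqv_def Q_add Q_mult)
qed

lemma eqv_mult_left: "y \<approx> y' \<Longrightarrow> x \<in> D \<Longrightarrow> x * y \<approx> x * y'"
  using Q_mult[of x "y - y'"] by (simp add: eqv_def right_diff_distrib)

lemma eqv_power: "x \<approx> x' \<Longrightarrow> x \<in> D \<Longrightarrow> x' \<in> D \<Longrightarrow> x ^ j \<approx> x' ^ j"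
  by (induction j) (auto intro!: eqv_mult subring_power D)

lemma power_notin_Q: "c \<in> D \<Longrightarrow> c \<notin> Q \<Longrightarrow> c ^ s \<notin> Q"
  by (induction s) (use one_notin prime subring_power[OF D] in auto)

lemma poly_in_Q: "q \<in> poly_over Q \<Longrightarrow> x \<in> D \<Longrightarrow> poly q x \<in> Q"
  by (auto simp: poly_altdef poly_over_def intro!: Q_sum Q_mult2 subring_power D)

text \<open>Top coefficients in \<open>Q\<close> are zero in D/Q, and dropping them changes the
  value only by an element of \<open>Q\<close>. Afterwards the formal degree is the degree over D/Q,
  so arguments with leading coefficients apply.\<close>

lemma trim:
  assumes "q \<in> poly_over A" "q \<notin> poly_over Q" "is_subring A" "x \<in> D"
  obtains q' where "q' \<in> poly_over A" "degree q' \<le> degree q" "lead_coeff q' \<notin> Q" "poly q' x \<approx> poly q x"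
proof -
  let ?R = "{i. coeff q i \<notin> Q}"
  have R: "?R \<subseteq> {..degree q}" using Q_0 le_degree by force
  then have fin: "finite ?R" using finite_subset by blast
  have ne: "?R \<noteq> {}" using assms(2) by (auto simp: poly_over_def)
  define d where "d = Max ?R"
  have d: "d \<in> ?R" unfolding d_def by (rule Max_in[OF fin ne])
  define q' where "q' = poly_cutoff (Suc d) q"
  have c: "coeff q' i = (if i \<le> d then coeff q i else 0)" for i
    by (simp add: q'_def coeff_poly_cutoff less_Suc_eq_le)
  have "coeff q' d \<noteq> 0" using d c Q_0 by force
  then have dq: "degree q' = d" using c by (intro antisym degree_le le_degree) auto
  have "q - q' \<in> poly_over Q"
    using Max_ge[OF fin] by (force simp: poly_over_def c d_def Q_0)
  then have "poly (q - q') x \<in> Q" using assms(4) by (rule poly_in_Q)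
  then have "poly q' x \<approx> poly q x" by (metis eqv_def eqv_sym poly_diff)
  then show thesis
    using assms d dq R c by (intro that[of q']) (auto simp: poly_over_def subring_0)
qed

text \<open>Modulo \<open>Q\<close>, every element of \<open>A\<close> that becomes invertible in
  A'[1/b] is already invertible in A[1/a], where \<open>a\<close> depends on \<open>b\<close> alone.
  If \<open>A\<close> consists of the integers, all primes that divide powers of \<open>b\<close> in
  \<open>A'\<close> modulo \<open>Q\<close> thus divide powers of one fixed integer, nonzero modulo
  \<open>Q\<close>.\<close>

definition units_descend :: "'r set \<Rightarrow> 'r set \<Rightarrow> bool" where
  "units_descend A A' \<longleftrightarrow> (\<forall>b\<in>A' - Q. \<exists>a\<in>A - Q. \<forall>u\<in>A. \<forall>j. \<forall>g\<in>A'.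
     u * g \<approx> b ^ j \<longrightarrow> (\<exists>i. \<exists>g'\<in>A. u * g' \<approx> a ^ i))"

lemma units_descend_trans:
  "units_descend A A' \<Longrightarrow> units_descend A' A'' \<Longrightarrow> A \<subseteq> A' \<Longrightarrow> units_descend A A''"
  unfolding units_descend_def by (meson subsetD)

text \<open>Congruences between values at \<open>x\<close> hold coefficient by coefficient. If
  \<open>b\<close> is the value of \<open>q'\<close>, then comparing \<open>u * g\<close> with
  \<open>b ^ j\<close> at the exponent \<open>j * degree q'\<close> shows that \<open>u\<close>
  divides a power of the leading coefficient of \<open>q'\<close>, which serves as
  \<open>a\<close>.\<close>

lemma units_descend_transcendental:
  assumes A: "is_subring A" "A \<subseteq> D" and x: "x \<in> D"
    and tr: "\<And>q. q \<in> poly_over A \<Longrightarrow> poly q x \<in> Q \<Longrightarrow> q \<in> poly_over Q"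
  shows "units_descend A (adjoin A x)"
  unfolding units_descend_def
proof
  note P = poly_over_subring[OF A(1)]
  fix b assume b: "b \<in> adjoin A x - Q"
  then obtain q where q: "q \<in> poly_over A" "poly q x = b" by (auto simp: adjoin_def)
  have "q \<notin> poly_over Q" using poly_in_Q[OF _ x, of q] q b by auto
  from trim[OF q(1) this A(1) x] obtain q' where q': "q' \<in> poly_over A" "lead_coeff q' \<notin> Q"
    "poly q' x \<approx> poly q x" by blast
  have bD: "b \<in> D" "poly q' x \<in> D"
    using b adjoin_subset[OF D A(2) x] q'(1) unfolding adjoin_def by blast+
  show "\<exists>a\<in>A - Q. \<forall>u\<in>A. \<forall>j. \<forall>g\<in>adjoin A x. u * g \<approx> b ^ j \<longrightarrow> (\<exists>i. \<exists>g'\<in>A. u * g' \<approx> a ^ i)"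
  proof (intro bexI ballI allI impI)
    show "lead_coeff q' \<in> A - Q" using q' by (auto simp: poly_over_def)
    fix u j g assume u: "u \<in> A" "g \<in> adjoin A x" "u * g \<approx> b ^ j"
    then obtain r where r: "r \<in> poly_over A" "poly r x = g" by (auto simp: adjoin_def)
    have "b ^ j \<approx> poly q' x ^ j"
      using q' q bD by (intro eqv_power) (auto intro: eqv_sym)
    with u(3) have "u * g \<approx> poly q' x ^ j" by (rule eqv_trans)
    then have "poly (smult u r - q' ^ j) x \<in> Q"
      using r by (simp add: eqv_def poly_power)
    then have "smult u r - q' ^ j \<in> poly_over Q"
      using A q' r u by (intro tr) (auto intro!: subring_diff[OF P] poly_over_smult subring_power[OF P])
    then have "coeff (smult u r - q' ^ j) (j * degree q') \<in> Q" unfolding poly_over_def by blast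
    then have "u * coeff r (j * degree q') \<approx> lead_coeff q' ^ j"
      by (simp add: eqv_def coeff_power_times_degree)
    then show "\<exists>i. \<exists>g'\<in>A. u * g' \<approx> lead_coeff q' ^ i"
      using r(1) by (auto simp: poly_over_def)
  qed
qed

text \<open>Here \<open>q\<close> is a minimal polynomial of \<open>x\<close> over \<open>A\<close>
  modulo \<open>Q\<close>. Among the polynomials over \<open>A\<close> whose value at
  \<open>x\<close> is a nonzero multiple of \<open>b\<close>, one of least degree turns out to be
  constant. This replaces inverting \<open>b\<close> in the field of fractions.\<close>

lemma algebraic_multiple_in_base:
  assumes A: "is_subring A" "A \<subseteq> D" and x: "x \<in> D" and b: "b \<in> adjoin A x" "b \<notin> Q"
    and q: "q \<in> poly_over A" "lead_coeff q \<notin> Q" "poly q x \<in> Q"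
    and min: "\<And>r. r \<in> poly_over A \<Longrightarrow> poly r x \<in> Q \<Longrightarrow> degree r < degree q \<Longrightarrow> r \<in> poly_over Q"
  shows "\<exists>a\<in>A - Q. \<exists>t\<in>adjoin A x. a \<approx> t * b"
proof -
  note P = poly_over_subring[OF A(1)]
  note AX = adjoin_subring[OF A(1), of x]
  have AD: "adjoin A x \<subseteq> D" by (rule adjoin_subset[OF D A(2) x])
  have ev: "poly r x \<in> adjoin A x" if "r \<in> poly_over A" for r using that by (auto simp: adjoin_def)
  have evD: "poly r x \<in> D" if "r \<in> poly_over A" for r using ev[OF that] AD by blast
  define c where "c = lead_coeff q"
  have c: "c \<in> A" using q by (auto simp: c_def poly_over_def)
  have dq: "degree q > 0"
  proof (rule ccontr)
    assume "\<not> degree q > 0"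
    then obtain c where "q = [:c:]" by (metis degree_eq_zeroE gr0I)
    then show False using q by simp
  qed
  define good where "good h \<longleftrightarrow> h \<in> poly_over A \<and> poly h x \<notin> Q \<and> (\<exists>t\<in>adjoin A x. poly h x \<approx> t * b)" for h
  obtain h0 where "h0 \<in> poly_over A" "poly h0 x = b" using b by (auto simp: adjoin_def)
  then have "good h0" unfolding good_def using b subring_1[OF AX] by (auto intro!: bexI[of _ 1])
  then obtain h1 where h1: "good h1" "\<And>r. good r \<Longrightarrow> degree h1 \<le> degree r"
    using ex_has_least_nat[of good h0 degree] by blast
  have "h1 \<notin> poly_over Q" using poly_in_Q[OF _ x] h1(1) by (auto simp: good_def)
  then obtain h where h: "h \<in> poly_over A" "degree h \<le> degree h1" "lead_coeff h \<notin> Q" "poly h x \<approx> poly h1 x"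
    using trim[OF _ _ A(1) x] h1(1) unfolding good_def by metis
  have gh: "good h"
    using h h1(1) eqv_in_Q[OF h(4)] eqv_trans[OF h(4)] unfolding good_def by blast
  have hmin: "degree h \<le> degree r" if "good r" for r using h(2) h1(2)[OF that] by linarith
  obtain t where t: "t \<in> adjoin A x" "poly h x \<approx> t * b" using gh by (auto simp: good_def)
  have hQ: "poly h x \<notin> Q" using gh by (simp add: good_def)
  \<comment> \<open>Reduction modulo \<open>q\<close> changes the value at \<open>x\<close> only by
    the factor \<open>c ^ s\<close>, which is nonzero modulo \<open>Q\<close>. The remainder is
    therefore good as well.\<close>
  have "degree h < degree q"
  proof -
    obtain s w r where w: "w \<in> poly_over A" "r \<in> poly_over A" "smult (c ^ s) h = q * w + r"
      "degree r < degree q \<or> r = 0"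
      using pseudo_division[OF A(1) q(1) h(1)] unfolding c_def by blast
    have "poly q x * poly w x + poly r x = c ^ s * poly h x"
      using arg_cong[OF w(3), of "\<lambda>p. poly p x"] by simp
    then have "poly r x - c ^ s * poly h x = - (poly q x * poly w x)" by (simp add: algebra_simps)
    then have e: "poly r x \<approx> c ^ s * poly h x"
      unfolding eqv_def using Q_uminus[OF Q_mult2[OF q(3) evD[OF w(1)]]] by simp
    have cD: "c ^ s \<in> D" "c \<in> D" using c A subring_power by blast+
    have "poly r x \<notin> Q"
      using eqv_in_Q[OF e] prime[OF cD(1) evD[OF h(1)]] hQ power_notin_Q[OF cD(2), of s] q(2) by (auto simp: c_def)
    moreover have "poly r x \<approx> (c ^ s * t) * b"
      using eqv_trans[OF e eqv_mult_left[OF t(2) cD(1)]] by (simp add: mult.assoc)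
    moreover have "c ^ s * t \<in> adjoin A x"
      using subring_mult[OF AX] subring_power[OF AX] t c adjoin_superset[OF A(1)] by blast
    ultimately have "good r" using w unfolding good_def by blast
    from hmin[OF this] show ?thesis using w(4) dq by auto
  qed
  \<comment> \<open>Now \<open>q\<close> is divided by \<open>h\<close>. A remainder with value
    outside \<open>Q\<close> would be good and of smaller degree. Otherwise the quotient
    \<open>w\<close> vanishes at \<open>x\<close>, so minimality of \<open>q\<close> puts all its
    coefficients into \<open>Q\<close>, contradicting the leading coefficient of
    \<open>h * w + r\<close>.\<close>
  have "degree h = 0"
  proof (rule ccontr)
    assume dh: "degree h \<noteq> 0"
    define c' where "c' = lead_coeff h"
    have c': "c' \<in> A" using h by (auto simp: c'_def poly_over_def)
    obtain s w r where w: "w \<in> poly_over A" "r \<in> poly_over A" "smult (c' ^ s) q = h * w + r"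
      "degree r < degree h \<or> r = 0" "degree w \<le> degree q - degree h"
      using pseudo_division[OF A(1) h(1) q(1)] unfolding c'_def by blast
    have dr: "degree r < degree h" using w(4) dh by auto
    have c'D: "c' ^ s \<in> D" "c' \<in> D" using c' A subring_power by blast+
    have "poly h x * poly w x + poly r x = c' ^ s * poly q x"
      using arg_cong[OF w(3), of "\<lambda>p. poly p x"] by simp
    then have sumQ: "poly h x * poly w x + poly r x \<in> Q" using Q_mult[OF c'D(1) q(3)] by simp
    have rQ: "poly r x \<in> Q"
    proof (rule ccontr)
      assume r: "poly r x \<notin> Q"
      have "poly r x \<approx> - poly w x * poly h x" using sumQ by (simp add: eqv_def algebra_simps)
      also have "- poly w x * poly h x \<approx> - poly w x * (t * b)"
        by (intro eqv_mult_left t subring_uminus[OF D] evD w)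
      finally have "poly r x \<approx> (- poly w x * t) * b" by (simp add: mult.assoc)
      moreover have "- poly w x * t \<in> adjoin A x"
        by (intro subring_mult[OF AX] subring_uminus[OF AX] ev w t)
      ultimately have "good r" using w r unfolding good_def by blast
      from hmin[OF this] show False using dr by simp
    qed
    then have "poly h x * poly w x \<in> Q" using Q_diff[OF sumQ rQ] by simp
    then have "poly w x \<in> Q" using prime[OF evD evD] h(1) w(1) hQ by blast
    then have "w \<in> poly_over Q" using w(5) dh \<open>degree h < degree q\<close> by (intro min w) auto
    then have "coeff (h * w) (degree q) \<in> Q"
      using h(1) A unfolding coeff_mult by (intro Q_sum Q_mult) (auto simp: poly_over_def)
    moreover have "coeff (h * w) (degree q) = c' ^ s * c"
      using arg_cong[OF w(3), of "\<lambda>p. coeff p (degree q)"] dr \<open>degree h < degree q\<close>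
      by (simp add: c_def coeff_eq_0)
    ultimately show False
      using prime[OF c'D(1)] power_notin_Q[OF c'D(2)] c A(2) q(2) h(3) unfolding c_def c'_def by auto
  qed
  then obtain a where "h = [:a:]" by (metis degree_eq_zeroE)
  then show ?thesis using h gh t by (intro bexI[of _ a] bexI[of _ t]) (auto simp: good_def poly_over_def coeff_pCons split: nat.splits)
qed

text \<open>With \<open>a \<approx> t * b\<close>, a relation \<open>u * g \<approx> b ^ j\<close>
  becomes \<open>u * (g * t ^ j) \<approx> a ^ j\<close>. Reducing the second factor modulo the
  minimal polynomial \<open>q\<close> costs a power of its leading coefficient \<open>c\<close>, and
  the constant coefficient of the result gives a relation inside \<open>A\<close>.\<close>

lemma units_descend_algebraic:
  assumes A: "is_subring A" "A \<subseteq> D" and x: "x \<in> D"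
    and q0: "q0 \<in> poly_over A" "poly q0 x \<in> Q" "q0 \<notin> poly_over Q"
  shows "units_descend A (adjoin A x)"
  unfolding units_descend_def
proof
  note P = poly_over_subring[OF A(1)]
  fix b assume b: "b \<in> adjoin A x - Q"
  have AD: "adjoin A x \<subseteq> D" by (rule adjoin_subset[OF D A(2) x])
  define alg where "alg r \<longleftrightarrow> r \<in> poly_over A \<and> poly r x \<in> Q \<and> lead_coeff r \<notin> Q" for r
  have ex: "\<exists>r'. alg r' \<and> degree r' \<le> degree r"
    if "r \<in> poly_over A" "poly r x \<in> Q" "r \<notin> poly_over Q" for r
    using trim[OF that(1,3) A(1) x] that(2) eqv_in_Q unfolding alg_def by metis
  obtain q where q: "alg q" "\<And>r. alg r \<Longrightarrow> degree q \<le> degree r"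
    using ex[OF q0] ex_has_least_nat[of alg _ degree] by blast
  have min: "r \<in> poly_over Q" if "r \<in> poly_over A" "poly r x \<in> Q" "degree r < degree q" for r
    using ex[OF that(1,2)] q(2) that(3) by (meson leD le_trans)
  define c where "c = lead_coeff q"
  have c: "c \<in> A" "c \<notin> Q" "q \<in> poly_over A" "poly q x \<in> Q"
    using q by (auto simp: c_def poly_over_def alg_def)
  obtain a t where a: "a \<in> A" "a \<notin> Q" and t: "t \<in> adjoin A x" "a \<approx> t * b"
    using algebraic_multiple_in_base[OF A x _ _ c(3) _ c(4) min] b c(2) unfolding c_def by blast
  have dq: "degree q > 0"
  proof (rule ccontr)
    assume "\<not> degree q > 0"
    then obtain d where "q = [:d:]" by (metis degree_eq_zeroE gr0I)
    then show False using c c_def by simp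
  qed
  show "\<exists>a\<in>A - Q. \<forall>u\<in>A. \<forall>j. \<forall>g\<in>adjoin A x. u * g \<approx> b ^ j \<longrightarrow> (\<exists>i. \<exists>g'\<in>A. u * g' \<approx> a ^ i)"
  proof (intro bexI ballI allI impI)
    \<comment> \<open>The factor \<open>a\<close> comes from clearing \<open>b\<close>, the factor
      \<open>c\<close> from the pseudo-division by \<open>q\<close>.\<close>
    show "c * a \<in> A - Q" using c a A prime subring_mult by blast
    fix u j g assume u: "u \<in> A" "g \<in> adjoin A x" "u * g \<approx> b ^ j"
    obtain \<gamma> \<tau> where r: "\<gamma> \<in> poly_over A" "poly \<gamma> x = g" "\<tau> \<in> poly_over A" "poly \<tau> x = t"
      using u t by (auto simp: adjoin_def)
    have "\<gamma> * \<tau> ^ j \<in> poly_over A" by (intro subring_mult[OF P] subring_power[OF P] r)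
    then obtain s w r where w: "w \<in> poly_over A" "r \<in> poly_over A"
      "smult (c ^ s) (\<gamma> * \<tau> ^ j) = q * w + r" "degree r < degree q \<or> r = 0"
      using pseudo_division[OF A(1) c(3), of "\<gamma> * \<tau> ^ j"] unfolding c_def by blast
    have inD: "c ^ s \<in> D" "a \<in> D" "u \<in> D" "t \<in> D" "b \<in> D" "poly w x \<in> D" "g \<in> D"
      using u t b AD A c(1) a(1) subring_power[OF A(1)] w(1) by (auto simp: adjoin_def)
    have gt: "u * (g * t ^ j) \<approx> a ^ j"
    proof -
      have "u * (g * t ^ j) = t ^ j * (u * g)" by (simp add: mult_ac)
      also have "\<dots> \<approx> t ^ j * b ^ j" by (intro eqv_mult_left u subring_power D inD)
      also have "t ^ j * b ^ j = (t * b) ^ j" by (simp add: power_mult_distrib)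
      also have "\<dots> \<approx> a ^ j" by (intro eqv_power subring_mult D inD eqv_sym[OF t(2)])
      finally show ?thesis .
    qed
    have "poly q x * poly w x + poly r x = c ^ s * (g * t ^ j)"
      using arg_cong[OF w(3), of "\<lambda>p. poly p x"] r by (simp add: poly_power)
    then have "poly r x - c ^ s * (g * t ^ j) = - (poly q x * poly w x)" by (simp add: algebra_simps)
    then have "poly r x \<approx> c ^ s * (g * t ^ j)"
      unfolding eqv_def using Q_uminus[OF Q_mult2[OF c(4) inD(6)]] by simp
    then have "u * poly r x \<approx> u * (c ^ s * (g * t ^ j))" by (intro eqv_mult_left inD)
    also have "u * (c ^ s * (g * t ^ j)) = c ^ s * (u * (g * t ^ j))" by (simp add: mult_ac)
    also have "\<dots> \<approx> c ^ s * a ^ j" by (intro eqv_mult_left inD gt)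
    finally have "poly (smult u r - [:c ^ s * a ^ j:]) x \<in> Q" by (simp add: eqv_def)
    moreover have "smult u r - [:c ^ s * a ^ j:] \<in> poly_over A"
      by (intro subring_diff[OF P] poly_over_smult poly_over_const subring_mult subring_power A u w c a)
    moreover have "degree (smult u r - [:c ^ s * a ^ j:]) < degree q"
      using w(4) dq degree_smult_le[of u r] by (intro degree_diff_less) auto
    \<comment> \<open>A polynomial of degree below \<open>degree q\<close> that vanishes at
      \<open>x\<close> modulo \<open>Q\<close> has every coefficient in \<open>Q\<close>.\<close>
    ultimately have "coeff (smult u r - [:c ^ s * a ^ j:]) 0 \<in> Q"
      using min unfolding poly_over_def by blast
    then have "u * coeff r 0 \<approx> c ^ s * a ^ j" by (simp add: eqv_def)
    \<comment> \<open>The two exponents differ in general; the extra factors equalise them, which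
      gives a power of \<open>c * a\<close>.\<close>
    then have "c ^ j * a ^ s * (u * coeff r 0) \<approx> c ^ j * a ^ s * (c ^ s * a ^ j)"
      using A(2) c a by (intro eqv_mult_left subring_mult subring_power D) auto
    then have "u * (c ^ j * a ^ s * coeff r 0) \<approx> (c * a) ^ (s + j)"
      by (simp add: power_add power_mult_distrib mult_ac)
    moreover have "c ^ j * a ^ s * coeff r 0 \<in> A"
      using w(2) by (intro subring_mult subring_power A c a) (auto simp: poly_over_def)
    ultimately show "\<exists>i. \<exists>g'\<in>A. u * g' \<approx> (c * a) ^ i" by blast
  qed
qed

lemma units_descend_adjoin:
  assumes "is_subring A" "A \<subseteq> D" "x \<in> D"
  shows "units_descend A (adjoin A x)"
  using units_descend_algebraic[OF assms] units_descend_transcendental[OF assms] by blast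

lemma units_descend_finitely_generated:
  assumes "finite G" "G \<subseteq> D" and A: "is_subring A" "A \<subseteq> D"
  shows "\<exists>A'. is_subring A' \<and> A \<subseteq> A' \<and> A' \<subseteq> D \<and> G \<subseteq> A' \<and> units_descend A A'"
  using assms(1,2)
proof (induction G)
  case empty
  then show ?case using A by (auto simp: units_descend_def)
next
  case (insert x G)
  then obtain A' where A': "is_subring A'" "A \<subseteq> A'" "A' \<subseteq> D" "G \<subseteq> A'" "units_descend A A'" by blast
  have "units_descend A (adjoin A' x)"
    using A' insert.prems by (intro units_descend_trans[OF A'(5) units_descend_adjoin]) auto
  then show ?case
    using A' adjoin_subring[OF A'(1)] adjoin_superset[OF A'(1), of x] adjoin_generator[OF A'(1), of x]
      adjoin_subset[OF D A'(3), of x] insert.prems by (intro exI[of _ "adjoin A' x"]) auto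
qed

end

section \<open>Prime ideals and exponent lattices\<close>

lemma ideal_add_principal:
  assumes D: "is_subring D" and Q: "is_ideal_of Q D" and x: "x \<in> D"
  shows "is_ideal_of {q + x * d | q d. q \<in> Q \<and> d \<in> D} D" (is "is_ideal_of ?J D")
  unfolding is_ideal_of_def
proof (intro conjI ballI subsetI)
  have QD: "q \<in> Q \<Longrightarrow> q \<in> D" for q using Q by (auto simp: is_ideal_of_def)
  show "y \<in> D" if "y \<in> ?J" for y
    using that x QD by (auto intro!: subring_add[OF D] subring_mult[OF D])
  have "0 = 0 + x * 0" "0 \<in> Q" "0 \<in> D"
    using Q subring_0[OF D] by (simp_all add: is_ideal_of_def)
  then show "0 \<in> ?J" by blast
  show "y + z \<in> ?J" if yz: "y \<in> ?J" "z \<in> ?J" for y z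
  proof -
    obtain q d q' d' where *: "y = q + x * d" "z = q' + x * d'" "q \<in> Q" "d \<in> D" "q' \<in> Q" "d' \<in> D"
      using yz by blast
    then have "y + z = (q + q') + x * (d + d')" "q + q' \<in> Q" "d + d' \<in> D"
      using Q by (auto simp: algebra_simps is_ideal_of_def intro: subring_add[OF D])
    then show ?thesis by blast
  qed
  show "y * z \<in> ?J" if yz: "y \<in> D" "z \<in> ?J" for y z
  proof -
    obtain q d where *: "z = q + x * d" "q \<in> Q" "d \<in> D"
      using yz by blast
    then have "y * z = y * q + x * (y * d)" "y * q \<in> Q" "y * d \<in> D"
      using Q yz by (auto simp: algebra_simps is_ideal_of_def intro: subring_mult[OF D])
    then show ?thesis by blast
  qed
qed

text \<open>By Zorn's lemma there is an ideal maximal among those that contain \<open>I\<close> and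
  avoid \<open>M\<close>. Any such ideal is prime.\<close>

lemma ex_prime_avoiding:
  assumes D: "is_subring D" and I: "is_ideal_of I D"
    and M: "1 \<in> M" "\<And>x y. x \<in> M \<Longrightarrow> y \<in> M \<Longrightarrow> x * y \<in> M" and disj: "I \<inter> M = {}"
  obtains Q where "prime_in_subring D Q" "I \<subseteq> Q" "Q \<inter> M = {}"
proof -
  define \<I> where "\<I> = {J. is_ideal_of J D \<and> I \<subseteq> J \<and> J \<inter> M = {}}"
  have "\<exists>Q\<in>\<I>. \<forall>X\<in>\<I>. Q \<subseteq> X \<longrightarrow> X = Q"
  proof (rule subset_Zorn_nonempty)
    show "\<I> \<noteq> {}" using I disj by (auto simp: \<I>_def)
    fix \<C> assume ne: "\<C> \<noteq> {}" and ch: "subset.chain \<I> \<C>"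
    have mem: "is_ideal_of J D" "I \<subseteq> J" "J \<inter> M = {}" if "J \<in> \<C>" for J
      using ch that by (auto simp: subset.chain_def \<I>_def)
    have "x + y \<in> \<Union>\<C>" if xy: "x \<in> \<Union>\<C>" "y \<in> \<Union>\<C>" for x y
    proof -
      from xy obtain J1 J2 where J: "J1 \<in> \<C>" "J2 \<in> \<C>" "x \<in> J1" "y \<in> J2" by blast
      then have "J1 \<subseteq> J2 \<or> J2 \<subseteq> J1" using ch by (auto simp: subset.chain_def)
      then obtain J where "J \<in> \<C>" "x \<in> J" "y \<in> J" using J by blast
      then show ?thesis using mem(1)[of J] by (auto simp: is_ideal_of_def)
    qed
    moreover have "\<Union>\<C> \<subseteq> D" "0 \<in> \<Union>\<C>" "x \<in> D \<Longrightarrow> y \<in> \<Union>\<C> \<Longrightarrow> x * y \<in> \<Union>\<C>" for x y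
      using mem(1) ne unfolding is_ideal_of_def by blast+
    ultimately have "is_ideal_of (\<Union>\<C>) D" unfolding is_ideal_of_def by blast
    then show "\<Union>\<C> \<in> \<I>" using mem(2,3) ne unfolding \<I>_def by blast
  qed
  then obtain Q where Q: "is_ideal_of Q D" "I \<subseteq> Q" "Q \<inter> M = {}"
    and max: "\<And>X. is_ideal_of X D \<Longrightarrow> I \<subseteq> X \<Longrightarrow> X \<inter> M = {} \<Longrightarrow> Q \<subseteq> X \<Longrightarrow> X = Q"
    unfolding \<I>_def by auto
  have meet: "\<exists>q\<in>Q. \<exists>d\<in>D. q + x * d \<in> M" if x: "x \<in> D" "x \<notin> Q" for x
  proof (rule ccontr)
    let ?X = "{q + x * d | q d. q \<in> Q \<and> d \<in> D}"
    assume "\<not> ?thesis"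
    then have "?X \<inter> M = {}" by blast
    moreover have "Q \<subseteq> ?X"
      using subring_0[OF D] by (force intro: exI[of _ 0])
    ultimately have "?X = Q" using Q x(1) by (intro max ideal_add_principal D) auto
    moreover have "x = 0 + x * 1" "0 \<in> Q" "1 \<in> D"
      using Q subring_1[OF D] by (simp_all add: is_ideal_of_def)
    ultimately show False using x(2) by blast
  qed
  have "prime_in_subring D Q"
  proof
    show "1 \<notin> Q" using Q M by blast
    fix x y assume xy: "x \<in> D" "y \<in> D" "x * y \<in> Q"
    show "x \<in> Q \<or> y \<in> Q"
    proof (rule ccontr)
      assume "\<not> ?thesis"
      then obtain q d q' d' where *: "q \<in> Q" "d \<in> D" "q + x * d \<in> M" "q' \<in> Q" "d' \<in> D" "q' + y * d' \<in> M"
        using meet xy by metis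
      \<comment> \<open>If neither \<open>x\<close> nor \<open>y\<close> lies in \<open>Q\<close>,
        both enlarged ideals meet \<open>M\<close>. The product of the two elements found lies in
        \<open>M\<close>, and by this expansion also in \<open>Q\<close>.\<close>
      have "(q + x * d) * (q' + y * d') = (q' + y * d') * q + (x * d) * q' + (d * d') * (x * y)"
        by (simp add: algebra_simps)
      moreover have "\<dots> \<in> Q"
      proof -
        have "q' \<in> D" using Q * by (auto simp: is_ideal_of_def)
        then have "q' + y * d' \<in> D" "x * d \<in> D" "d * d' \<in> D"
          using * xy D by (auto intro: subring_add subring_mult)
        then show ?thesis using Q(1) * xy unfolding is_ideal_of_def by simp
      qed
      ultimately show False using M(2)[OF *(3,6)] Q(3) by auto
    qed
  qed (use D Q in auto)
  then show thesis using that Q by blast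
qed

section \<open>Finite generation of groups of integer vectors\<close>

lemma fun_sum_apply: "(\<Sum>a\<in>A. h a) i = (\<Sum>a\<in>A. h a i)"
  by (induction A rule: infinite_finite_induct) simp_all

interpretation int_fun: module "\<lambda>(c::int) (v::'i \<Rightarrow> int) i. c * v i"
  by unfold_locales (auto simp: fun_eq_iff algebra_simps)

text \<open>Induction on the coordinates. The vectors vanishing at \<open>i\<close> are covered by
  the induction hypothesis, and one more generator \<open>w\<close> with least nonzero absolute
  value at \<open>i\<close> suffices: division with remainder by \<open>w i\<close> moves any other
  vector into that subgroup.\<close>

lemma int_fun_subspace_finitely_generated:
  assumes "finite I" "int_fun.subspace H" "\<And>v i. v \<in> H \<Longrightarrow> i \<notin> I \<Longrightarrow> v i = 0"
  shows "\<exists>G. finite G \<and> G \<subseteq> H \<and> H \<subseteq> int_fun.span G"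
  using assms
proof (induction I arbitrary: H)
  case empty
  then have "v = 0" if "v \<in> H" for v using that by (auto simp: fun_eq_iff)
  then show ?case using int_fun.span_zero by (intro exI[of _ "{}"]) auto
next
  case (insert i I)
  note H = insert.prems(1)
  define H' where "H' = {v \<in> H. v i = 0}"
  have "int_fun.subspace H'"
    using H by (auto simp: int_fun.subspace_def H'_def)
  moreover have "v j = 0" if "v \<in> H'" "j \<notin> I" for v j
    using that insert.prems(2)[of v j] by (cases "j = i") (auto simp: H'_def)
  ultimately obtain G where G: "finite G" "G \<subseteq> H'" "H' \<subseteq> int_fun.span G"
    using insert.IH[of H'] by blast
  show ?case
  proof (cases "H' = H")
    case True
    then show ?thesis using G by blast
  next
    case False
    then obtain v where v: "v \<in> H" "v i \<noteq> 0" by (auto simp: H'_def)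
    obtain w where w: "w \<in> H" "w i \<noteq> 0" and
      min: "\<And>u. u \<in> H \<Longrightarrow> u i \<noteq> 0 \<Longrightarrow> nat \<bar>w i\<bar> \<le> nat \<bar>u i\<bar>"
      using ex_has_least_nat[of "\<lambda>v. v \<in> H \<and> v i \<noteq> 0" v "\<lambda>v. nat \<bar>v i\<bar>"] v by blast
    have "u \<in> int_fun.span (insert w G)" if u: "u \<in> H" for u
    proof -
      define q where "q = u i div w i"
      define r where "r = u - (\<lambda>j. q * w j)"
      have r: "r \<in> H"
        unfolding r_def by (intro int_fun.subspace_diff H u int_fun.subspace_scale w)
      have "r i = u i mod w i" by (simp add: r_def q_def minus_div_mult_eq_mod)
      then have "\<bar>r i\<bar> < \<bar>w i\<bar>" using abs_mod_less[OF w(2)] by simp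
      then have "r i = 0" using min[OF r] by linarith
      then have "r \<in> int_fun.span G" using G r by (auto simp: H'_def)
      then have "r \<in> int_fun.span (insert w G)" using int_fun.span_mono[of G "insert w G"] by blast
      moreover have "(\<lambda>j. q * w j) \<in> int_fun.span (insert w G)"
        by (intro int_fun.span_scale int_fun.span_base) simp
      ultimately have "r + (\<lambda>j. q * w j) \<in> int_fun.span (insert w G)" by (rule int_fun.span_add)
      then show ?thesis by (simp add: r_def)
    qed
    then show ?thesis using G w by (intro exI[of _ "insert w G"]) (auto simp: H'_def)
  qed
qed

text \<open>The group spanned by \<open>F\<close> is finitely generated, and each generator is an
  integer combination of finitely many elements of \<open>F\<close>. Collecting these puts the
  generators into \<open>F\<close> itself, so that they are exponents of monomials and not just
  differences of such exponents.\<close>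

lemma finite_generators_of_exponents:
  fixes F :: "('i \<Rightarrow>\<^sub>0 nat) set"
  assumes I: "finite I" and F: "\<And>\<beta>. \<beta> \<in> F \<Longrightarrow> Poly_Mapping.keys \<beta> \<subseteq> I"
  shows "\<exists>G. finite G \<and> G \<subseteq> F \<and> (\<forall>\<beta>\<in>F. \<exists>z :: _ \<Rightarrow> int. \<forall>i.
    int (Poly_Mapping.lookup \<beta> i) = (\<Sum>g\<in>G. z g * int (Poly_Mapping.lookup g i)))"
proof -
  define \<iota> where "\<iota> \<beta> = (\<lambda>i. int (Poly_Mapping.lookup \<beta> i))" for \<beta> :: "'i \<Rightarrow>\<^sub>0 nat"
  have inj: "inj \<iota>" by (auto simp: inj_def \<iota>_def fun_eq_iff intro: poly_mapping_eqI)
  have "\<iota> \<beta> i = 0" if "\<beta> \<in> F" "i \<notin> I" for \<beta> i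
    using F[OF that(1)] that(2) by (auto simp: \<iota>_def in_keys_iff)
  then have "int_fun.span (\<iota> ` F) \<subseteq> {v. \<forall>i. i \<notin> I \<longrightarrow> v i = 0}"
    by (intro int_fun.span_minimal) (auto simp: int_fun.subspace_def)
  then have supp: "v i = 0" if "v \<in> int_fun.span (\<iota> ` F)" "i \<notin> I" for v i
    using that by (simp add: subset_iff)
  have fg: "\<exists>G'. finite G' \<and> G' \<subseteq> int_fun.span (\<iota> ` F) \<and> int_fun.span (\<iota> ` F) \<subseteq> int_fun.span G'"
    by (rule int_fun_subspace_finitely_generated[OF I int_fun.subspace_span]) (rule supp)
  obtain G' where G': "finite G'" "G' \<subseteq> int_fun.span (\<iota> ` F)" "int_fun.span (\<iota> ` F) \<subseteq> int_fun.span G'"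
    using fg by blast
  have "\<exists>Y. finite Y \<and> Y \<subseteq> \<iota> ` F \<and> v \<in> int_fun.span Y" if v: "v \<in> G'" for v
  proof -
    obtain Y r where Y: "finite Y" "Y \<subseteq> \<iota> ` F" "v = (\<Sum>a\<in>Y. (\<lambda>i. r a * a i))"
      using v G'(2) unfolding int_fun.span_explicit by blast
    have "v \<in> int_fun.span Y"
      unfolding Y(3) by (intro int_fun.span_sum int_fun.span_scale int_fun.span_base)
    then show ?thesis using Y by blast
  qed
  then obtain Y where Y: "\<And>v. v \<in> G' \<Longrightarrow> finite (Y v) \<and> Y v \<subseteq> \<iota> ` F \<and> v \<in> int_fun.span (Y v)" by metis
  have "finite (\<Union>(Y ` G'))" "\<Union>(Y ` G') \<subseteq> \<iota> ` F" using Y G'(1) by auto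
  then obtain G where G: "G \<subseteq> F" "finite G" "\<Union>(Y ` G') = \<iota> ` G"
    using finite_subset_image[of "\<Union>(Y ` G')" \<iota> F] by blast
  have "G' \<subseteq> int_fun.span (\<iota> ` G)"
    unfolding G(3)[symmetric] using Y int_fun.span_mono[of "Y _" "\<Union>(Y ` G')"] by blast
  then have "int_fun.span G' \<subseteq> int_fun.span (\<iota> ` G)" by (intro int_fun.span_minimal int_fun.subspace_span)
  then have sub: "\<iota> ` F \<subseteq> int_fun.span (\<iota> ` G)" using G'(3) int_fun.span_superset by blast
  have "\<exists>z. \<forall>i. int (Poly_Mapping.lookup \<beta> i) = (\<Sum>g\<in>G. z g * int (Poly_Mapping.lookup g i))" if \<beta>: "\<beta> \<in> F" for \<beta>
  proof -
    obtain u where "\<iota> \<beta> = (\<Sum>v\<in>\<iota> ` G. (\<lambda>i. u v * v i))"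
      using sub \<beta> G(2) by (auto simp: int_fun.span_finite)
    also have "\<dots> = (\<Sum>g\<in>G. (\<lambda>i. u (\<iota> g) * \<iota> g i))"
      using inj by (simp add: sum.reindex inj_on_subset)
    finally have "\<iota> \<beta> i = (\<Sum>g\<in>G. u (\<iota> g) * \<iota> g i)" for i
      by (simp add: fun_sum_apply)
    then show ?thesis by (intro exI[of _ "\<lambda>g. u (\<iota> g)"]) (simp add: \<iota>_def)
  qed
  then show ?thesis using G by blast
qed

section \<open>Integers in ideals of monoid rings\<close>

abbreviation xpow :: "('i \<Rightarrow>\<^sub>0 nat) \<Rightarrow> ('i \<Rightarrow>\<^sub>0 nat) \<Rightarrow>\<^sub>0 int" where
  "xpow \<alpha> \<equiv> Poly_Mapping.single \<alpha> 1"

lemma xpow_add: "xpow (\<alpha> + \<beta>) = xpow \<alpha> * xpow \<beta>"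
  by (simp add: Poly_Mapping.mult_single)

lemma xpow_power_prod:
  assumes "finite G"
  shows "\<exists>\<delta>. (\<Prod>g\<in>G. xpow g ^ m g) = xpow \<delta> \<and>
    (\<forall>i. Poly_Mapping.lookup \<delta> i = (\<Sum>g\<in>G. m g * Poly_Mapping.lookup g i))"
  using assms
proof (induction G)
  case empty
  then show ?case by (intro exI[of _ 0]) simp
next
  case (insert g G)
  have "\<exists>\<delta>. xpow g ^ k = xpow \<delta> \<and> (\<forall>i. Poly_Mapping.lookup \<delta> i = k * Poly_Mapping.lookup g i)" for k
  proof (induction k)
    case 0
    then show ?case by (intro exI[of _ 0]) simp
  next
    case (Suc k)
    then obtain \<delta> where "xpow g ^ k = xpow \<delta>" "\<And>i. Poly_Mapping.lookup \<delta> i = k * Poly_Mapping.lookup g i" by blast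
    then show ?case by (intro exI[of _ "g + \<delta>"]) (simp add: xpow_add lookup_add)
  qed
  then obtain \<delta> where "xpow g ^ m g = xpow \<delta>" "\<And>i. Poly_Mapping.lookup \<delta> i = m g * Poly_Mapping.lookup g i" by blast
  moreover obtain \<epsilon> where "(\<Prod>g\<in>G. xpow g ^ m g) = xpow \<epsilon>"
    "\<And>i. Poly_Mapping.lookup \<epsilon> i = (\<Sum>g\<in>G. m g * Poly_Mapping.lookup g i)" using insert.IH by blast
  ultimately show ?case using insert.hyps
    by (intro exI[of _ "\<delta> + \<epsilon>"]) (simp add: xpow_add lookup_add)
qed

text \<open>The exponents in \<open>F\<close> are integer combinations of those in \<open>G\<close>,
  possibly with negative coefficients. Multiplying by a high power of the product of all generators
  makes every coefficient nonnegative.\<close>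

lemma xpow_finite_generation:
  fixes F :: "('i \<Rightarrow>\<^sub>0 nat) set"
  assumes I: "finite I" and F: "\<And>\<beta>. \<beta> \<in> F \<Longrightarrow> Poly_Mapping.keys \<beta> \<subseteq> I"
  shows "\<exists>G. finite G \<and> G \<subseteq> F \<and>
    (\<forall>\<beta>\<in>F. \<exists>j m. xpow \<beta> * (\<Prod>g\<in>G. xpow g) ^ j = (\<Prod>g\<in>G. xpow g ^ m g))"
proof -
  obtain G where G: "finite G" "G \<subseteq> F" and z: "\<And>\<beta>. \<beta> \<in> F \<Longrightarrow> \<exists>z :: _ \<Rightarrow> int. \<forall>i.
      int (Poly_Mapping.lookup \<beta> i) = (\<Sum>g\<in>G. z g * int (Poly_Mapping.lookup g i))"
    using finite_generators_of_exponents[OF I F] by metis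
  have "\<exists>j m. xpow \<beta> * (\<Prod>g\<in>G. xpow g) ^ j = (\<Prod>g\<in>G. xpow g ^ m g)" if \<beta>: "\<beta> \<in> F" for \<beta>
  proof -
    obtain z :: "_ \<Rightarrow> int" where z:
      "\<And>i. int (Poly_Mapping.lookup \<beta> i) = (\<Sum>g\<in>G. z g * int (Poly_Mapping.lookup g i))" using z[OF \<beta>] by blast
    \<comment> \<open>As \<open>j\<close> bounds every \<open>\<bar>z g\<bar>\<close>, all the sums
      \<open>z g + int j\<close> are nonnegative and \<open>nat\<close> loses nothing.\<close>
    define j where "j = (\<Sum>g\<in>G. nat \<bar>z g\<bar>)"
    define m where "m g = nat (z g + int j)" for g
    have m: "int (m g) = z g + int j" if "g \<in> G" for g
    proof -
      have "nat \<bar>z g\<bar> \<le> j" unfolding j_def using that G(1) by (intro member_le_sum) auto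
      then show ?thesis unfolding m_def by linarith
    qed
    obtain \<gamma> where \<gamma>: "(\<Prod>g\<in>G. xpow g ^ j) = xpow \<gamma>"
      "\<And>i. Poly_Mapping.lookup \<gamma> i = (\<Sum>g\<in>G. j * Poly_Mapping.lookup g i)"
      using xpow_power_prod[OF G(1), of "\<lambda>_. j"] by blast
    obtain \<delta> where \<delta>: "(\<Prod>g\<in>G. xpow g ^ m g) = xpow \<delta>"
      "\<And>i. Poly_Mapping.lookup \<delta> i = (\<Sum>g\<in>G. m g * Poly_Mapping.lookup g i)"
      using xpow_power_prod[OF G(1), of m] by blast
    have "\<beta> + \<gamma> = \<delta>"
    proof (rule poly_mapping_eqI)
      fix i
      have "int (Poly_Mapping.lookup \<delta> i) = (\<Sum>g\<in>G. (z g + int j) * int (Poly_Mapping.lookup g i))"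
        by (simp add: \<delta>(2) m)
      also have "\<dots> = int (Poly_Mapping.lookup (\<beta> + \<gamma>) i)"
        by (simp add: lookup_add \<gamma>(2) z distrib_right sum.distrib)
      finally show "Poly_Mapping.lookup (\<beta> + \<gamma>) i = Poly_Mapping.lookup \<delta> i" by simp
    qed
    then have "xpow \<beta> * (\<Prod>g\<in>G. xpow g) ^ j = (\<Prod>g\<in>G. xpow g ^ m g)"
      unfolding \<delta>(1) prod_power_distrib \<gamma>(1) xpow_add[symmetric] by simp
    then show ?thesis by blast
  qed
  then show ?thesis using G by blast
qed

section \<open>Monoid rings over the integers\<close>

definition monoid_ring :: "('i \<Rightarrow>\<^sub>0 nat) set \<Rightarrow> (('i \<Rightarrow>\<^sub>0 nat) \<Rightarrow>\<^sub>0 int) set" where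
  "monoid_ring B = {g. Poly_Mapping.keys g \<subseteq> B}"

lemma monoid_ring_subring:
  fixes B :: "('i \<Rightarrow>\<^sub>0 nat) set"
  assumes "0 \<in> B" "\<And>\<alpha> \<beta>. \<alpha> \<in> B \<Longrightarrow> \<beta> \<in> B \<Longrightarrow> \<alpha> + \<beta> \<in> B"
  shows "is_subring (monoid_ring B)"
  unfolding is_subring_def monoid_ring_def
proof (intro conjI ballI)
  show "1 \<in> {g :: ('i \<Rightarrow>\<^sub>0 nat) \<Rightarrow>\<^sub>0 int. Poly_Mapping.keys g \<subseteq> B}" using assms(1) by simp
  fix x y :: "('i \<Rightarrow>\<^sub>0 nat) \<Rightarrow>\<^sub>0 int"
  assume xy: "x \<in> {g. Poly_Mapping.keys g \<subseteq> B}" "y \<in> {g. Poly_Mapping.keys g \<subseteq> B}"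
  show "x - y \<in> {g. Poly_Mapping.keys g \<subseteq> B}" using xy keys_diff[of x y] by blast
  show "x * y \<in> {g. Poly_Mapping.keys g \<subseteq> B}" using xy keys_mult[of x y] assms(2) by blast
qed

lemma (in prime_in_subring) prod_notin_Q:
  "(\<And>g. g \<in> G \<Longrightarrow> h g \<in> D \<and> h g \<notin> Q) \<Longrightarrow> prod h G \<in> D \<and> prod h G \<notin> Q"
  by (induction G rule: infinite_finite_induct)
    (use one_notin prime in \<open>auto intro: subring_mult D subring_1\<close>)

lemma subring_prod: "is_subring A \<Longrightarrow> (\<And>i. i \<in> K \<Longrightarrow> h i \<in> A) \<Longrightarrow> prod h K \<in> A"
  by (induction K rule: infinite_finite_induct) (auto intro: subring_1 subring_mult)

lemma poly_mapping_as_sum: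
  fixes g :: "'i \<Rightarrow>\<^sub>0 'b::comm_monoid_add"
  shows "g = (\<Sum>\<alpha>\<in>Poly_Mapping.keys g. Poly_Mapping.single \<alpha> (Poly_Mapping.lookup g \<alpha>))"
  by (rule poly_mapping_eqI) (simp add: lookup_sum lookup_single when_def in_keys_iff)

text \<open>If \<open>I\<close> contained no positive integer, some prime ideal \<open>Q\<close>
  above \<open>I\<close> would contain none either, so that the quotient is a domain of
  characteristic zero. Descending divisibility to the integers then produces a nonzero integer
  divisible by every prime in \<open>P\<close>.\<close>

lemma monoid_ring_ideal_contains_positive_integer:
  assumes fin: "finite K" and B: "\<And>\<beta>. \<beta> \<in> B \<Longrightarrow> Poly_Mapping.keys \<beta> \<subseteq> K"
    and B0: "0 \<in> B" and Badd: "\<And>\<alpha> \<beta>. \<alpha> \<in> B \<Longrightarrow> \<beta> \<in> B \<Longrightarrow> \<alpha> + \<beta> \<in> B"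
    and I: "is_ideal_of I (monoid_ring B)"
    and k: "k \<ge> 1" and P: "infinite P" "\<And>p. p \<in> P \<Longrightarrow> prime p"
    and dvd: "\<And>p. p \<in> P \<Longrightarrow> \<exists>c\<in>monoid_ring B. of_nat k - of_nat p * c \<in> I"
  shows "\<exists>m\<ge>1::nat. of_nat m \<in> I"
proof (rule ccontr)
  assume contra: "\<not> ?thesis"
  let ?M = "{of_nat m | m :: nat. m \<ge> 1} :: (('a \<Rightarrow>\<^sub>0 nat) \<Rightarrow>\<^sub>0 int) set"
  have SB: "is_subring (monoid_ring B)" by (rule monoid_ring_subring[OF B0 Badd])
  have M: "x * y \<in> ?M" if xy: "x \<in> ?M" "y \<in> ?M" for x y
  proof -
    obtain m m' :: nat where "x = of_nat m" "y = of_nat m'" "m \<ge> 1" "m' \<ge> 1" using xy by blast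
    then show ?thesis by (intro CollectI exI[of _ "m * m'"]) simp
  qed
  have M1: "1 \<in> ?M" by (intro CollectI exI[of _ 1]) simp
  have "I \<inter> ?M = {}" using contra by blast
  then obtain Q where IQ: "prime_in_subring (monoid_ring B) Q" "I \<subseteq> Q" "Q \<inter> ?M = {}"
    using ex_prime_avoiding[OF SB I M1 M] by blast
  interpret prime_in_subring "monoid_ring B" Q by (fact IQ(1))
  write eqv (infix \<open>\<approx>\<close> 50)
  have no_nat: "of_nat m \<notin> Q" if "m \<ge> 1" for m :: nat using IQ(3) that by blast
  have no_int: "z = 0" if z: "of_int z \<in> Q" for z :: int
  proof (rule ccontr)
    assume "z \<noteq> 0"
    then have "nat \<bar>z\<bar> \<ge> 1" by linarith
    moreover have "of_nat (nat \<bar>z\<bar>) \<in> Q"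
      using z Q_uminus[OF z] by (simp add: abs_if of_nat_nat split: if_splits)
    ultimately show False using no_nat by blast
  qed
  \<comment> \<open>Only monomials that survive modulo \<open>Q\<close> matter. \<open>B\<close>
    need not be a finitely generated monoid, but the group generated by \<open>F\<close> is finitely
    generated.\<close>
  define F where "F = {\<beta> \<in> B. xpow \<beta> \<notin> Q}"
  have FK: "Poly_Mapping.keys \<beta> \<subseteq> K" if "\<beta> \<in> F" for \<beta>
    using B that by (simp add: F_def)
  obtain G where G: "finite G" "G \<subseteq> F" and
    gen: "\<forall>\<beta>\<in>F. \<exists>j m. xpow \<beta> * (\<Prod>g\<in>G. xpow g) ^ j = (\<Prod>g\<in>G. xpow g ^ m g)"
    using xpow_finite_generation[of K F, OF fin FK] by blast
  have xB: "xpow \<beta> \<in> monoid_ring B" if "\<beta> \<in> B" for \<beta> using that by (simp add: monoid_ring_def)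
  let ?Z = "range of_int :: (('a \<Rightarrow>\<^sub>0 nat) \<Rightarrow>\<^sub>0 int) set"
  have Z: "is_subring ?Z"
    unfolding is_subring_def by (metis (no_types, lifting) of_int_1 of_int_diff of_int_mult rangeE rangeI)
  have intB: "of_int z \<in> monoid_ring B" for z
    using subring_of_nat[OF D] subring_uminus[OF D] by (cases z rule: int_cases2) simp_all
  have ZD: "?Z \<subseteq> monoid_ring B" using intB by blast
  have GD: "xpow ` G \<subseteq> monoid_ring B" using G xB by (auto simp: F_def)
  obtain A where A: "is_subring A" "?Z \<subseteq> A" "A \<subseteq> monoid_ring B" "xpow ` G \<subseteq> A" "units_descend ?Z A"
    using units_descend_finitely_generated[OF finite_imageI[OF G(1)] GD Z ZD] by blast
  \<comment> \<open>Multiplied by a suitable power of \<open>b\<close>, every element of the monoid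
    ring becomes congruent to an element of \<open>A\<close>: surviving monomials land in
    \<open>A\<close>, and the others are congruent to zero.\<close>
  define b where "b = (\<Prod>g\<in>G. xpow g)"
  have bA: "b \<in> A" unfolding b_def using A by (intro subring_prod) auto
  have bQ: "b \<notin> Q" unfolding b_def using prod_notin_Q[of G xpow] G xB by (auto simp: F_def)
  have bD: "b \<in> monoid_ring B" using bA A by blast
  have monom: "\<exists>j. \<exists>g\<in>A. (of_int z * xpow \<beta>) * b ^ j \<approx> g" if "\<beta> \<in> B" for \<beta> z
  proof (cases "\<beta> \<in> F")
    case True
    then obtain j m where "xpow \<beta> * b ^ j = (\<Prod>g\<in>G. xpow g ^ m g)" using gen unfolding b_def by blast
    moreover have "(\<Prod>g\<in>G. xpow g ^ m g) \<in> A" using A by (intro subring_prod subring_power) auto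
    moreover have "of_int z \<in> A" using A by blast
    ultimately have "(of_int z * xpow \<beta>) * b ^ j \<in> A" using A(1) by (simp add: mult.assoc subring_mult)
    then show ?thesis using eqv_refl by blast
  next
    case False
    then have "of_int z * xpow \<beta> \<approx> 0" using that intB Q_mult by (simp add: F_def eqv_0)
    then have "(of_int z * xpow \<beta>) * b ^ 0 \<approx> 0" by simp
    then show ?thesis using subring_0[OF A(1)] by blast
  qed
  have sum_clear: "\<exists>j. \<exists>g\<in>A. (\<Sum>\<alpha>\<in>L. of_int (y \<alpha>) * xpow \<alpha>) * b ^ j \<approx> g"
    if "finite L" "L \<subseteq> B" for L y
    using that
  proof (induction L)
    case empty
    then show ?case using subring_0[OF A(1)] by (intro exI[of _ 0] bexI[of _ 0]) auto
  next
    case (insert \<alpha> L)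
    let ?s = "\<Sum>\<alpha>\<in>L. of_int (y \<alpha>) * xpow \<alpha>"
    let ?t = "of_int (y \<alpha>) * xpow \<alpha>"
    obtain j g where g: "g \<in> A" "?s * b ^ j \<approx> g" using insert by auto
    obtain i h where h: "h \<in> A" "?t * b ^ i \<approx> h" using monom[of \<alpha> "y \<alpha>"] insert.prems by auto
    have e: "(?t + ?s) * b ^ (i + j) - (h * b ^ j + g * b ^ i)
        = b ^ j * (?t * b ^ i - h) + b ^ i * (?s * b ^ j - g)"
      by (simp add: algebra_simps power_add)
    have "(?t + ?s) * b ^ (i + j) \<approx> h * b ^ j + g * b ^ i"
      unfolding eqv_def e using g(2) h(2) unfolding eqv_def
      by (intro Q_add Q_mult subring_power D bD)
    moreover have "h * b ^ j + g * b ^ i \<in> A"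
      by (intro subring_add subring_mult subring_power A(1) g h bA)
    ultimately show ?case using insert.hyps by auto
  qed
  have clear: "\<exists>j. \<exists>g\<in>A. c * b ^ j \<approx> g" if "c \<in> monoid_ring B" for c
  proof -
    have "c = (\<Sum>\<alpha>\<in>Poly_Mapping.keys c. of_int (Poly_Mapping.lookup c \<alpha>) * xpow \<alpha>)"
      by (subst poly_mapping_as_sum) (simp add: Poly_Mapping.mult_single flip: single_of_int)
    then show ?thesis using sum_clear[of "Poly_Mapping.keys c" "Poly_Mapping.lookup c"] that
      by (simp add: monoid_ring_def)
  qed
  have natD: "of_nat l \<in> monoid_ring B" for l by (rule subring_of_nat[OF D])
  \<comment> \<open>The descent is applied to this product since each \<open>p\<close> in
    \<open>P\<close> divides one of its powers: \<open>p\<close> divides \<open>k\<close> in the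
    monoid ring modulo \<open>Q\<close>, and \<open>b\<close> brings the quotient into
    \<open>A\<close>.\<close>
  have "of_nat k * b \<in> A - Q"
    using subring_mult[OF A(1) subring_of_nat[OF A(1)] bA] prime[OF natD bD] no_nat[OF k] bQ by blast
  then obtain a where a: "a \<in> ?Z - Q" and desc: "\<And>u j g. u \<in> ?Z \<Longrightarrow> g \<in> A \<Longrightarrow>
      u * g \<approx> (of_nat k * b) ^ j \<Longrightarrow> \<exists>i. \<exists>g'\<in>?Z. u * g' \<approx> a ^ i"
    using A(5) unfolding units_descend_def by metis
  obtain z where z: "a = of_int z" using a by blast
  have "z \<noteq> 0" using a z Q_0 by auto
  have "int p dvd z" if p: "p \<in> P" for p
  proof -
    obtain c where c: "c \<in> monoid_ring B" "of_nat p * c \<approx> of_nat k"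
      using dvd[OF p] IQ(2) eqv_sym unfolding eqv_def by blast
    obtain j g where g: "g \<in> A" "c * b ^ j \<approx> g" using clear[OF c(1)] by blast
    \<comment> \<open>These factors complete \<open>k * b ^ j\<close> to the power of
      \<open>of_nat k * b\<close> with exponent \<open>Suc j\<close>.\<close>
    let ?r = "b * of_nat k ^ j"
    have "of_nat p * (g * ?r) = (of_nat p * ?r) * g" by (simp add: mult_ac)
    also have "\<dots> \<approx> (of_nat p * ?r) * (c * b ^ j)"
      by (intro eqv_mult_left eqv_sym[OF g(2)] subring_mult subring_power natD D bD)
    also have "\<dots> = (?r * b ^ j) * (of_nat p * c)" by (simp add: mult_ac)
    also have "\<dots> \<approx> (?r * b ^ j) * of_nat k"
      by (intro eqv_mult_left c subring_mult subring_power natD D bD)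
    also have "\<dots> = (of_nat k * b) ^ Suc j" by (simp add: power_mult_distrib mult_ac)
    finally have "of_nat p * (g * ?r) \<approx> (of_nat k * b) ^ Suc j" .
    moreover have "g * ?r \<in> A" by (intro subring_mult subring_power subring_of_nat A(1) g bA)
    moreover have "of_nat p \<in> ?Z" by (metis of_int_of_nat_eq rangeI)
    ultimately obtain i g' where "g' \<in> ?Z" "of_nat p * g' \<approx> a ^ i" using desc by metis
    then obtain y where "of_nat p * of_int y \<approx> a ^ i" by blast
    then have "of_int (int p * y - z ^ i) \<in> Q" by (simp add: eqv_def z)
    then have "z ^ i = int p * y" using no_int by fastforce
    then have "int p dvd z ^ i" by simp
    then show ?thesis using P(2)[OF p] prime_dvd_power by (metis prime_int_nat_transfer nat_int of_nat_0_le_iff prime_nat_int_transfer)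
  qed
  then have "P \<subseteq> {p. p dvd nat \<bar>z\<bar>}" by (auto simp: nat_abs_dvd_iff int_dvd_int_iff dvd_nat_abs_iff)
  moreover have "finite {p. p dvd nat \<bar>z\<bar>}"
    using \<open>z \<noteq> 0\<close> by (intro finite_divisors_nat) linarith
  ultimately show False using P(1) finite_subset by blast
qed

section \<open>Divisibility and torsion in commutative semigroups\<close>

lemma multiple_add:
  fixes a :: "'a::ab_semigroup_add"
  assumes "i \<ge> 1" "j \<ge> 1"
  shows "multiple (i + j) a = multiple i a + multiple j a"
  using assms(1) by (induction i rule: dec_induct) (simp_all add: multiple_Suc multiple_Suc[OF assms(2)] add.assoc)

lemma multiple_multiple:
  fixes a :: "'a::ab_semigroup_add"
  assumes "i \<ge> 1" "j \<ge> 1"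
  shows "multiple i (multiple j a) = multiple (i * j) a"
  using assms(1)
proof (induction i rule: dec_induct)
  case (step i)
  then have "multiple (j + i * j) a = multiple j a + multiple (i * j) a"
    using assms(2) by (intro multiple_add) auto
  then show ?case using step by (simp add: multiple_Suc)
qed simp

text \<open>By the pigeonhole principle, finitely many multiples force a repetition. Conversely, a
  multiple from \<open>m + r\<close> on can be moved back by \<open>r\<close> until it falls below
  \<open>m + r\<close>.\<close>

lemma torsion_iff:
  fixes a :: "'a::ab_semigroup_add"
  shows "torsion a \<longleftrightarrow> (\<exists>m\<ge>1. \<exists>r\<ge>1. multiple (m + r) a = multiple m a)"
proof
  assume "torsion a"
  then have "finite ((\<lambda>l. multiple l a) ` {1..})"
    unfolding torsion_def by (rule back_subst[of finite]) auto
  moreover have "infinite {1::nat..}" by (rule infinite_Ici)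
  ultimately obtain i where "i \<in> {1::nat..}" "infinite {j \<in> {1..}. multiple j a = multiple i a}"
    using pigeonhole_infinite by blast
  then obtain j where j: "j > i" "multiple j a = multiple i a" "i \<ge> 1"
    unfolding infinite_nat_iff_unbounded by auto
  then show "\<exists>m\<ge>1. \<exists>r\<ge>1. multiple (m + r) a = multiple m a"
    by (intro exI[of _ i] conjI exI[of _ "j - i"]) auto
next
  assume "\<exists>m\<ge>1. \<exists>r\<ge>1. multiple (m + r) a = multiple m a"
  then obtain m r where mr: "m \<ge> 1" "r \<ge> 1" "multiple (m + r) a = multiple m a" by blast
  have "multiple l a \<in> (\<lambda>l. multiple l a) ` {1..<m + r}" if "l \<ge> 1" for l
    using that
  proof (induction l rule: less_induct)
    case (less l)
    show ?case
    proof (cases "l < m + r")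
      case False
      have "multiple l a = multiple (l - r) a"
      proof (cases "l = m + r")
        case neq: False
        have "multiple ((m + r) + (l - (m + r))) a = multiple (m + (l - (m + r))) a"
          using mr neq False by (subst (1 2) multiple_add) auto
        moreover have "m + (l - (m + r)) = l - r" "(m + r) + (l - (m + r)) = l" using False by auto
        ultimately show ?thesis by simp
      qed (use mr in simp)
      moreover have "l - r < l" "l - r \<ge> 1" using False mr by auto
      ultimately show ?thesis using less.IH by metis
    qed (use less in auto)
  qed
  then have "{multiple l a | l. l \<ge> 1} \<subseteq> (\<lambda>l. multiple l a) ` {1..<m + r}" by blast
  then show "torsion a" unfolding torsion_def by (rule finite_subset) simp
qed

lemma multiple_periodic:
  fixes a :: "'a::ab_semigroup_add"
  assumes "m \<ge> 1" "r \<ge> 1" "multiple (m + r) a = multiple m a" "i \<ge> m"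
  shows "multiple (i + r * t) a = multiple i a"
proof (induction t)
  case (Suc t)
  let ?i = "i + r * t"
  have "multiple (?i + r) a = multiple ?i a"
  proof (cases "?i = m")
    case False
    have e: "?i + r = (m + r) + (?i - m)" "?i = m + (?i - m)" using assms(4) by auto
    have "multiple ((m + r) + (?i - m)) a = multiple (m + r) a + multiple (?i - m) a"
      using False assms by (intro multiple_add) auto
    also have "\<dots> = multiple (m + (?i - m)) a"
      using False assms by (subst multiple_add) auto
    finally show ?thesis using e by metis
  qed (use assms in simp)
  then show ?case using Suc by (simp add: algebra_simps)
qed simp

lemma infinite_primes_gt: "infinite {p::nat. prime p \<and> p > r}"
proof
  assume "finite {p::nat. prime p \<and> p > r}"
  moreover have "{p::nat. prime p} \<subseteq> {p. prime p \<and> p > r} \<union> {..r}" by auto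
  ultimately have "finite {p::nat. prime p}" by (meson finite_UnI finite_atMost finite_subset)
  then show False using primes_infinite by blast
qed

text \<open>A prime above \<open>r\<close> is invertible modulo \<open>r\<close>. Hence
  \<open>k\<close> is congruent modulo \<open>r\<close> to some multiple of the prime that is at
  least \<open>k\<close>, and periodicity identifies the two multiples of \<open>a\<close>.\<close>

lemma strongly_almost_divisible_of_period:
  fixes a :: "'a::ab_semigroup_add"
  assumes k: "k \<ge> 1" and r: "r \<ge> 1" and per: "\<And>t. multiple (k + r * t) a = multiple k a"
  shows "strongly_almost_divisible (multiple k a)"
  unfolding strongly_almost_divisible_def
proof (rule exI[of _ "{p. prime p \<and> p > r}"], intro conjI ballI)
  show "infinite {p::nat. prime p \<and> p > r}" by (rule infinite_primes_gt)
  fix p :: nat assume p: "p \<in> {p. prime p \<and> p > r}"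
  then show "prime p" by simp
  have "coprime p r"
    using p r by (intro prime_imp_coprime_nat) (auto dest: nat_dvd_not_less)
  then obtain x where "[p * x = 1] (mod r)" using cong_solve_coprime_nat by auto
  then have "[p * x * k = 1 * k] (mod r)" by (rule cong_scalar_right)
  then have x: "[p * (x * k) = k] (mod r)" by (simp add: mult.assoc)
  \<comment> \<open>The summand \<open>r * k\<close> does not affect the residue modulo
    \<open>r\<close>; it ensures \<open>j' \<ge> k\<close>, so that \<open>p * j'\<close> is reached
    from \<open>k\<close> by adding periods.\<close>
  define j' where "j' = x * k + r * k"
  have kj: "k \<le> j'" using r unfolding j'_def by (simp add: trans_le_add2)
  also have "j' \<le> p * j'" using p by simp
  finally have ge: "k \<le> p * j'" .
  have "p * j' = p * (x * k) + (p * k) * r" by (simp add: j'_def algebra_simps)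
  then have "[p * j' = k] (mod r)" using x by (simp add: cong_def)
  then obtain t where "p * j' = t * r + k" using ge by (metis cong_le_nat cong_sym)
  then have "p * j' = k + r * t" by simp
  moreover have "p \<ge> 1" "j' \<ge> 1" using p k kj by auto
  ultimately have "multiple k a = multiple p (multiple j' a)"
    using per[of t] by (simp add: multiple_multiple)
  then show "\<exists>c. multiple k a = multiple p c" by blast
qed

lemma torsion_imp_almost_divisible:
  fixes a :: "'a::ab_semigroup_add"
  assumes "torsion a"
  shows "almost_divisible a"
proof -
  obtain m r where mr: "m \<ge> 1" "r \<ge> 1" "multiple (m + r) a = multiple m a"
    using assms unfolding torsion_iff by blast
  then show ?thesis
    unfolding almost_divisible_def
    using strongly_almost_divisible_of_period[OF mr(1,2) multiple_periodic[OF mr order_refl]] by blast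
qed

lemma strongly_almost_divisible_imp_almost_divisible:
  "strongly_almost_divisible a \<Longrightarrow> almost_divisible a"
  unfolding almost_divisible_def by (intro exI[of _ 1]) simp

text \<open>Regularity makes \<open>a + b\<close> act as a zero on \<open>a\<close>. Adding
  \<open>m\<close> copies of it to \<open>a\<close> moves the computation into the periodic range,
  so the multiples of \<open>a\<close> are periodic from index 1 on.\<close>

lemma regular_torsion_imp_strongly_almost_divisible:
  fixes a :: "'a::ab_semigroup_add"
  assumes "regular a" "torsion a"
  shows "strongly_almost_divisible a"
proof -
  obtain m r where mr: "m \<ge> 1" "r \<ge> 1" "multiple (m + r) a = multiple m a"
    using assms unfolding torsion_iff by blast
  obtain b where b: "a = a + b + a" using assms unfolding regular_def by blast
  have absorb: "a + multiple i (a + b) = a" if "i \<ge> 1" for i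
    using that
  proof (induction i rule: dec_induct)
    case base
    then show ?case using b by (simp add: ac_simps)
  next
    case (step i)
    have "a + multiple (Suc i) (a + b) = (a + b + a) + multiple i (a + b)"
      using step by (simp add: multiple_Suc ac_simps)
    then show ?case using b step by simp
  qed
  have split: "multiple i (a + b) = multiple i a + multiple i b" if "i \<ge> 1" for i
    using that by (induction i rule: dec_induct) (simp_all add: multiple_Suc ac_simps)
  have period: "multiple (1 + r * t) a = multiple 1 a" for t
  proof (cases "t = 0")
    case False
    have "multiple (1 + r * t) a = a + multiple (r * t) a"
      using False mr by (subst multiple_add) auto
    also have "\<dots> = (a + multiple m (a + b)) + multiple (r * t) a" using absorb[OF mr(1)] by simp
    also have "\<dots> = a + (multiple m a + multiple (r * t) a) + multiple m b"
      using split[OF mr(1)] by (simp add: ac_simps)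
    also have "multiple m a + multiple (r * t) a = multiple m a"
      using multiple_periodic[OF mr order_refl, of t] multiple_add[of m "r * t" a] mr False by simp
    also have "a + multiple m a + multiple m b = a"
      using split[OF mr(1)] absorb[OF mr(1)] by (simp add: ac_simps)
    finally show ?thesis by simp
  qed simp
  have "strongly_almost_divisible (multiple 1 a)"
    by (rule strongly_almost_divisible_of_period[OF order_refl mr(2) period])
  then show ?thesis by simp
qed

text \<open>
  The period has to be uniform: it is applied to the quotient of \<open>a\<close> by a prime that exceeds \<open>m\<close>.
\<close>

lemma uniformly_periodic_imp_regular:
  fixes a :: "'a::ab_semigroup_add"
  assumes "m \<ge> 1" "r \<ge> 1" and per: "\<And>c::'a. multiple (m + r) c = multiple m c"
    and a: "strongly_almost_divisible a"
  shows "regular a"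
proof -
  obtain P where P: "infinite P" "\<forall>p\<in>P. \<exists>c. a = multiple p c"
    using a unfolding strongly_almost_divisible_def by blast
  then obtain p c where p: "p > m" "a = multiple p c"
    unfolding infinite_nat_iff_unbounded by meson
  \<comment> \<open>Because \<open>p > m\<close>, periodicity already holds at \<open>p\<close>, and
    \<open>a\<close> equals \<open>1 + r * 2\<close> times itself. The period is doubled so that
    \<open>r * 2 - 1\<close> is at least 1 even for \<open>r = 1\<close> and the middle summand is a
    genuine multiple.\<close>
  have "a = multiple (p + r * p * 2) c"
    using multiple_periodic[OF assms(1,2) per, of p "p * 2" c] p by (simp add: mult.assoc)
  also have "p + r * p * 2 = (1 + r * 2) * p" by simp
  also have "multiple ((1 + r * 2) * p) c = multiple (1 + r * 2) a"
    using p assms(1) by (subst multiple_multiple[symmetric]) auto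
  also have "\<dots> = a + multiple (r * 2) a" using assms(2) by (subst multiple_add) auto
  also have "multiple (r * 2) a = multiple (r * 2 - 1) a + a"
    using multiple_add[of "r * 2 - 1" 1 a] assms(2) by simp
  finally have "a = a + multiple (r * 2 - 1) a + a" by (simp add: add.assoc)
  then show ?thesis unfolding regular_def by blast
qed

section \<open>Images of monoid semirings\<close>

text \<open>Positive coefficients cannot cancel, so a defining sum is nonzero; conversely,
  enumerating the support of such a polynomial yields a defining sum. Membership thereby reduces to
  support and signs.\<close>

lemma monoid_semiring_iff:
  "g \<in> monoid_semiring C \<longleftrightarrow>
     g \<noteq> 0 \<and> Poly_Mapping.keys g \<subseteq> C \<and> (\<forall>\<alpha>. Poly_Mapping.lookup g \<alpha> \<ge> 0)"
proof
  assume "g \<in> monoid_semiring C"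
  then obtain m :: nat and k \<alpha> where g: "g = (\<Sum>i=1..m. Poly_Mapping.single (\<alpha> i) (int (k i)))"
    and m: "m \<ge> 1" "\<And>i. i \<in> {1..m} \<Longrightarrow> k i \<ge> 1 \<and> \<alpha> i \<in> C"
    unfolding monoid_semiring_def by blast
  have l: "Poly_Mapping.lookup g \<beta> = (\<Sum>i=1..m. if \<alpha> i = \<beta> then int (k i) else 0)" for \<beta>
    by (simp add: g lookup_sum lookup_single when_def)
  have nn: "Poly_Mapping.lookup g \<beta> \<ge> 0" for \<beta> unfolding l by (intro sum_nonneg) simp
  have "(if \<alpha> 1 = \<alpha> 1 then int (k 1) else 0) \<le> Poly_Mapping.lookup g (\<alpha> 1)"
    unfolding l by (rule member_le_sum[where i = 1 and f = "\<lambda>i. if \<alpha> i = \<alpha> 1 then int (k i) else 0"]) (use m in auto)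
  then have "Poly_Mapping.lookup g (\<alpha> 1) \<noteq> 0" using m(2)[of 1] m(1) by auto
  then have "g \<noteq> 0" by auto
  moreover have "\<beta> \<in> C" if "\<beta> \<in> Poly_Mapping.keys g" for \<beta>
  proof (rule ccontr)
    assume "\<beta> \<notin> C"
    then have "Poly_Mapping.lookup g \<beta> = 0"
      unfolding l using m(2) by (intro sum.neutral) auto
    then show False using that by (simp add: in_keys_iff)
  qed
  ultimately show "g \<noteq> 0 \<and> Poly_Mapping.keys g \<subseteq> C \<and> (\<forall>\<alpha>. Poly_Mapping.lookup g \<alpha> \<ge> 0)" using nn by blast
next
  assume g: "g \<noteq> 0 \<and> Poly_Mapping.keys g \<subseteq> C \<and> (\<forall>\<alpha>. Poly_Mapping.lookup g \<alpha> \<ge> 0)"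
  let ?m = "card (Poly_Mapping.keys g)"
  obtain h where h: "bij_betw h {1..?m} (Poly_Mapping.keys g)"
    using ex_bij_betw_nat_finite_1[OF finite_keys] by blast
  have "g = (\<Sum>\<alpha>\<in>Poly_Mapping.keys g. Poly_Mapping.single \<alpha> (Poly_Mapping.lookup g \<alpha>))"
    by (rule poly_mapping_as_sum)
  also have "\<dots> = (\<Sum>i=1..?m. Poly_Mapping.single (h i) (int (nat (Poly_Mapping.lookup g (h i)))))"
    using g by (simp add: sum.reindex_bij_betw[OF h, symmetric])
  finally have "g = \<dots>" .
  moreover have "?m \<ge> 1" using g by (simp add: Suc_le_eq card_gt_0_iff)
  moreover have "nat (Poly_Mapping.lookup g (h i)) \<ge> 1 \<and> h i \<in> C" if "i \<in> {1..?m}" for i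
  proof -
    have "h i \<in> Poly_Mapping.keys g" using h that by (auto simp: bij_betw_def)
    moreover from this have "Poly_Mapping.lookup g (h i) > 0"
      using g by (metis in_keys_iff order_le_less)
    ultimately show ?thesis using g by auto
  qed
  ultimately show "g \<in> monoid_semiring C"
    unfolding monoid_semiring_def
    by (intro CollectI exI[of _ ?m] exI[of _ "\<lambda>i. nat (Poly_Mapping.lookup g (h i))"] exI[of _ h]) blast
qed

lemma monoid_semiring_induct [consumes 1, case_names single add]:
  assumes "g \<in> monoid_semiring C"
    and single: "\<And>\<alpha> k. \<alpha> \<in> C \<Longrightarrow> k \<ge> 1 \<Longrightarrow> R (of_nat k * xpow \<alpha>)"
    and add: "\<And>x y. R x \<Longrightarrow> R y \<Longrightarrow> R (x + y)"
  shows "R g"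
proof -
  obtain m :: nat and k \<alpha> where g: "g = (\<Sum>i=1..m. Poly_Mapping.single (\<alpha> i) (int (k i)))"
    and m: "m \<ge> 1" "\<And>i. i \<in> {1..m} \<Longrightarrow> k i \<ge> 1 \<and> \<alpha> i \<in> C"
    using assms(1) unfolding monoid_semiring_def by blast
  have s: "Poly_Mapping.single \<alpha> (int k) = of_nat k * xpow \<alpha>" for \<alpha> :: "nat \<Rightarrow>\<^sub>0 nat" and k
    by (simp add: Poly_Mapping.mult_single flip: single_of_nat)
  have "R (\<Sum>i=1..j. Poly_Mapping.single (\<alpha> i) (int (k i)))" if "j \<ge> 1" "j \<le> m" for j
    using that
  proof (induction j rule: dec_induct)
    case base
    then show ?case using m single[of "\<alpha> 1" "k 1"] by (simp add: s)
  next
    case (step j)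
    then show ?case using m(2)[of "Suc j"] single[of "\<alpha> (Suc j)" "k (Suc j)"]
      by (simp add: s add)
  qed
  then show ?thesis using m g by blast
qed

lemma monoid_semiring_add:
  "x \<in> monoid_semiring C \<Longrightarrow> y \<in> monoid_semiring C \<Longrightarrow> x + y \<in> monoid_semiring C"
proof -
  assume x: "x \<in> monoid_semiring C" and y: "y \<in> monoid_semiring C"
  then obtain \<alpha> where "Poly_Mapping.lookup x \<alpha> \<noteq> 0"
    by (metis monoid_semiring_iff poly_mapping_eqI lookup_zero)
  then have "Poly_Mapping.lookup (x + y) \<alpha> \<noteq> 0"
    using x y by (simp add: monoid_semiring_iff lookup_add add_nonneg_eq_0_iff)
  then have "x + y \<noteq> 0" by auto
  then show ?thesis
    using x y keys_add[of x y] by (auto simp: monoid_semiring_iff lookup_add)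
qed

lemma monoid_semiring_xpow: "k \<ge> 1 \<Longrightarrow> \<alpha> \<in> C \<Longrightarrow> of_nat k * xpow \<alpha> \<in> monoid_semiring C"
proof -
  assume "k \<ge> 1" "\<alpha> \<in> C"
  have e: "of_nat k * xpow \<alpha> = Poly_Mapping.single \<alpha> (int k)"
    by (simp add: Poly_Mapping.mult_single flip: single_of_nat)
  have "Poly_Mapping.lookup (Poly_Mapping.single \<alpha> (int k)) \<alpha> \<noteq> 0" using \<open>k \<ge> 1\<close> by simp
  then have "Poly_Mapping.single \<alpha> (int k) \<noteq> 0" by (metis lookup_zero)
  then show ?thesis
    using \<open>\<alpha> \<in> C\<close> unfolding e by (auto simp: monoid_semiring_iff lookup_single when_def)
qed

lemma monoid_semiring_mult:
  assumes C: "\<And>\<alpha> \<beta>. \<alpha> \<in> C \<Longrightarrow> \<beta> \<in> C \<Longrightarrow> \<alpha> + \<beta> \<in> C"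
    and "x \<in> monoid_semiring C" "y \<in> monoid_semiring C"
  shows "x * y \<in> monoid_semiring C"
  using assms(2)
proof (induction rule: monoid_semiring_induct)
  case (single \<alpha> k)
  from assms(3) show ?case
  proof (induction rule: monoid_semiring_induct)
    case inner: (single \<beta> l)
    have "of_nat (k * l) * xpow (\<alpha> + \<beta>) \<in> monoid_semiring C"
      using single inner C by (intro monoid_semiring_xpow) auto
    then show ?case by (simp add: xpow_add mult_ac)
  qed (simp add: distrib_left monoid_semiring_add)
qed (simp add: distrib_right monoid_semiring_add)

section \<open>Elements below a multiple of the unity\<close>

locale monoid_semiring_hom =
  fixes n :: nat and C :: "(nat \<Rightarrow>\<^sub>0 nat) set" and f :: "((nat \<Rightarrow>\<^sub>0 nat) \<Rightarrow>\<^sub>0 int) \<Rightarrow> 's::semiring"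
  assumes C: "submonoid_of_exponents n C"
    and hom: "semiring_hom_on (monoid_semiring C) f"
begin

abbreviation "T \<equiv> monoid_semiring C"

lemma T_mult: "x \<in> T \<Longrightarrow> y \<in> T \<Longrightarrow> x * y \<in> T"
  using C monoid_semiring_mult unfolding submonoid_of_exponents_def by blast

lemma T_of_nat: "k \<ge> 1 \<Longrightarrow> of_nat k \<in> T"
  using monoid_semiring_xpow[of k 0 C] C by (simp add: submonoid_of_exponents_def)

lemma T_1: "1 \<in> T"
  using T_of_nat[of 1] by simp

lemmas T_intros = monoid_semiring_add T_mult T_of_nat T_1

lemma f_add: "x \<in> T \<Longrightarrow> y \<in> T \<Longrightarrow> f (x + y) = f x + f y"
  and f_mult: "x \<in> T \<Longrightarrow> y \<in> T \<Longrightarrow> f (x * y) = f x * f y"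
  using hom by (auto simp: semiring_hom_on_def)

lemma multiple_f: "l \<ge> 1 \<Longrightarrow> x \<in> T \<Longrightarrow> multiple l (f x) = f (of_nat l * x)"
  by (induction l rule: dec_induct) (simp_all add: multiple_Suc f_add T_intros distrib_right)

text \<open>This says that \<open>f v\<close> lies below a multiple of \<open>f 1\<close> in the
  algebraic preorder. \<open>T\<close> has no zero, so \<open>g\<close> is always a nonzero
  polynomial: 1 is bounded through 1 + 1 = 2.\<close>

definition bounded :: "((nat \<Rightarrow>\<^sub>0 nat) \<Rightarrow>\<^sub>0 int) \<Rightarrow> bool" where
  "bounded v \<longleftrightarrow> v \<in> T \<and> (\<exists>g\<in>T. \<exists>l\<ge>1::nat. f (v + g) = f (of_nat l))"

lemma bounded_1: "bounded 1"
  unfolding bounded_def using T_1 by (intro conjI bexI[of _ 1] exI[of _ 2]) auto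

lemma bounded_add:
  assumes "bounded v" "bounded w"
  shows "bounded (v + w)"
proof -
  obtain g h and l m :: nat where *: "v \<in> T" "w \<in> T" "g \<in> T" "h \<in> T" "l \<ge> 1" "m \<ge> 1"
    "f (v + g) = f (of_nat l)" "f (w + h) = f (of_nat m)"
    using assms unfolding bounded_def by blast
  have "v + w + (g + h) = (v + g) + (w + h)" by (simp add: ac_simps)
  then have "f (v + w + (g + h)) = f (v + g) + f (w + h)"
    using * by (simp only: f_add[OF monoid_semiring_add monoid_semiring_add])
  also have "\<dots> = f (of_nat (l + m))"
    using f_add[OF T_of_nat T_of_nat, of l m] * by simp
  finally have "f (v + w + (g + h)) = f (of_nat (l + m))" .
  moreover have "v + w \<in> T" "g + h \<in> T" "l + m \<ge> 1" using * monoid_semiring_add by auto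
  ultimately show ?thesis unfolding bounded_def by blast
qed

lemma bounded_mult:
  assumes "bounded v" "bounded w"
  shows "bounded (v * w)"
proof -
  obtain g h and l m :: nat where *: "v \<in> T" "w \<in> T" "g \<in> T" "h \<in> T" "l \<ge> 1" "m \<ge> 1"
    "f (v + g) = f (of_nat l)" "f (w + h) = f (of_nat m)"
    using assms unfolding bounded_def by blast
  have "v * w + (v * h + g * w + g * h) = (v + g) * (w + h)" by (simp add: algebra_simps)
  then have "f (v * w + (v * h + g * w + g * h)) = f (of_nat (l * m))"
    using * by (simp add: f_mult monoid_semiring_add T_of_nat)
  moreover have "v * w \<in> T" "v * h + g * w + g * h \<in> T" "l * m \<ge> 1" using * by (auto intro: T_intros)
  ultimately show ?thesis unfolding bounded_def by blast
qed

lemma bounded_of_nat: "k \<ge> 1 \<Longrightarrow> bounded (of_nat k)"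
  by (induction k rule: dec_induct) (simp_all add: bounded_1 bounded_add)

lemma bounded_summand:
  assumes "bounded (v + u)" "v \<in> T" "u \<in> T"
  shows "bounded v"
proof -
  obtain g l where "g \<in> T" "l \<ge> (1::nat)" "f (v + u + g) = f (of_nat l)"
    using assms(1) unfolding bounded_def by blast
  then show ?thesis
    unfolding bounded_def using assms(2,3) monoid_semiring_add[of u C g]
    by (intro conjI bexI[of _ "u + g"] exI[of _ l]) (auto simp: add.assoc)
qed

definition B :: "(nat \<Rightarrow>\<^sub>0 nat) set" where
  "B = {\<alpha> \<in> C. bounded (xpow \<alpha>)}"

lemma B_0: "0 \<in> B"
  using C bounded_1 by (simp add: B_def submonoid_of_exponents_def)

lemma B_add: "\<alpha> \<in> B \<Longrightarrow> \<beta> \<in> B \<Longrightarrow> \<alpha> + \<beta> \<in> B"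
  using C bounded_mult by (simp add: B_def submonoid_of_exponents_def xpow_add)

lemma B_keys: "\<alpha> \<in> B \<Longrightarrow> Poly_Mapping.keys \<alpha> \<subseteq> {1..n}"
  using C by (auto simp: B_def submonoid_of_exponents_def exponents_def)

lemma B_subset_T: "v \<in> monoid_semiring B \<Longrightarrow> v \<in> T"
  by (auto simp: monoid_semiring_iff B_def)

lemma bounded_of_B: "v \<in> monoid_semiring B \<Longrightarrow> bounded v"
proof (induction rule: monoid_semiring_induct)
  case (single \<alpha> k)
  then show ?case by (intro bounded_mult bounded_of_nat) (auto simp: B_def)
qed (rule bounded_add)

text \<open>Every monomial occurring in \<open>c\<close> is a summand of
  \<open>of_nat p * c\<close>, and boundedness passes to summands.\<close>

lemma quotient_of_bounded:
  assumes c: "c \<in> T" and p: "p \<ge> (2::nat)" and b: "bounded (of_nat p * c)"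
  shows "c \<in> monoid_semiring B"
proof -
  have "\<alpha> \<in> B" if \<alpha>: "\<alpha> \<in> Poly_Mapping.keys c" for \<alpha>
  proof -
    have \<alpha>C: "\<alpha> \<in> C" using c \<alpha> by (auto simp: monoid_semiring_iff)
    define u where "u = of_nat p * c - xpow \<alpha>"
    have pc: "of_nat p * c \<in> T" using c p by (intro T_intros) auto
    have l: "Poly_Mapping.lookup (of_nat p * c) \<beta> = int p * Poly_Mapping.lookup c \<beta>" for \<beta>
      by (induction p) (simp_all add: distrib_right lookup_add)
    have pos: "Poly_Mapping.lookup c \<alpha> \<ge> 1"
      using c \<alpha> by (metis in_keys_iff monoid_semiring_iff order_le_less int_one_le_iff_zero_less)
    \<comment> \<open>With \<open>p \<ge> 2\<close> the coefficient at \<alpha> stays positive after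
      one copy of the monomial is removed, so the complement \<open>u\<close> is not the zero
      polynomial.\<close>
    have "int p * Poly_Mapping.lookup c \<alpha> \<ge> 2 * 1" using p pos by (intro mult_mono) auto
    then have ua: "Poly_Mapping.lookup u \<alpha> \<ge> 1" by (simp add: u_def lookup_minus l)
    moreover have "Poly_Mapping.lookup u \<beta> \<ge> 0" for \<beta>
      using ua pc by (cases "\<beta> = \<alpha>") (auto simp: u_def lookup_minus lookup_single monoid_semiring_iff)
    moreover have "Poly_Mapping.keys u \<subseteq> C"
      using keys_diff[of "of_nat p * c" "xpow \<alpha>"] pc \<alpha>C by (auto simp: u_def monoid_semiring_iff)
    ultimately have "u \<in> T" by (auto simp: monoid_semiring_iff)
    moreover have "xpow \<alpha> \<in> T" using monoid_semiring_xpow[of 1 \<alpha>] \<alpha>C by simp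
    ultimately show ?thesis using bounded_summand[of "xpow \<alpha>" u] b \<alpha>C by (simp add: B_def u_def)
  qed
  then show ?thesis using c by (auto simp: monoid_semiring_iff)
qed

text \<open>This is the kernel of the map from Z[B] to the difference ring of the image of N[B].
  Cancellation is built in, because a common summand may be added to both \<open>u\<close> and
  \<open>v\<close>.\<close>

definition kernel :: "((nat \<Rightarrow>\<^sub>0 nat) \<Rightarrow>\<^sub>0 int) set" where
  "kernel = {u - v | u v. u \<in> monoid_semiring B \<and> v \<in> monoid_semiring B \<and> f u = f v}"

lemma monoid_ring_difference:
  assumes "g \<in> monoid_ring B"
  obtains x y where "x \<in> monoid_semiring B" "y \<in> monoid_semiring B" "g = x - y"
proof -
  \<comment> \<open>The summand 1 keeps both \<open>h\<close> and \<open>g + h\<close> nonzero, as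
    the semiring excludes the zero polynomial.\<close>
  define h where "h = 1 + Poly_Mapping.map abs g"
  have l: "Poly_Mapping.lookup h \<alpha> = (if \<alpha> = 0 then 1 else 0) + \<bar>Poly_Mapping.lookup g \<alpha>\<bar>" for \<alpha>
    by (auto simp: h_def lookup_add Poly_Mapping.map.rep_eq lookup_one when_def)
  have "Poly_Mapping.keys h \<subseteq> B"
    using assms B_0 by (auto simp: monoid_ring_def in_keys_iff l subset_iff split: if_splits)
  moreover have "h \<noteq> 0" using l[of 0] by auto
  ultimately have h: "h \<in> monoid_semiring B" by (simp add: monoid_semiring_iff l)
  have "Poly_Mapping.lookup (g + h) 0 \<ge> 1" by (simp add: lookup_add l)
  then have "g + h \<noteq> 0" by auto
  moreover have "Poly_Mapping.lookup (g + h) \<alpha> \<ge> 0" for \<alpha>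
    using abs_ge_minus_self[of "Poly_Mapping.lookup g \<alpha>"] unfolding lookup_add l by (smt (verit))
  moreover have "Poly_Mapping.keys (g + h) \<subseteq> B"
    using keys_add[of g h] assms h by (auto simp: monoid_ring_def monoid_semiring_iff)
  ultimately have "g + h \<in> monoid_semiring B" by (simp add: monoid_semiring_iff)
  then show thesis using that[of "g + h" h] h by simp
qed

lemma kernel_ideal: "is_ideal_of kernel (monoid_ring B)"
  unfolding is_ideal_of_def
proof (intro conjI ballI subsetI)
  note Badd = monoid_semiring_add[of _ B] and Bmult = monoid_semiring_mult[OF B_add]
  show "x \<in> monoid_ring B" if x: "x \<in> kernel" for x
  proof -
    obtain u v where "x = u - v" "u \<in> monoid_semiring B" "v \<in> monoid_semiring B"
      using x unfolding kernel_def by blast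
    then show ?thesis using keys_diff[of u v] by (auto simp: monoid_ring_def monoid_semiring_iff)
  qed
  have "1 \<in> monoid_semiring B" using monoid_semiring_xpow[of 1 0 B] B_0 by simp
  moreover have "0 = 1 - (1 :: (nat \<Rightarrow>\<^sub>0 nat) \<Rightarrow>\<^sub>0 int)" by simp
  ultimately show "0 \<in> kernel" unfolding kernel_def by blast
  show "x + y \<in> kernel" if xy: "x \<in> kernel" "y \<in> kernel" for x y
  proof -
    obtain u v u' v' where *: "x = u - v" "y = u' - v'" "u \<in> monoid_semiring B" "v \<in> monoid_semiring B"
      "u' \<in> monoid_semiring B" "v' \<in> monoid_semiring B" "f u = f v" "f u' = f v'"
      using xy unfolding kernel_def by blast
    then have "f (u + u') = f (v + v')" by (simp add: f_add B_subset_T)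
    moreover have "x + y = (u + u') - (v + v')" using * by simp
    ultimately show ?thesis unfolding kernel_def using * Badd by blast
  qed
  show "g * x \<in> kernel" if gx: "g \<in> monoid_ring B" "x \<in> kernel" for g x
  proof -
    obtain u v where *: "x = u - v" "u \<in> monoid_semiring B" "v \<in> monoid_semiring B" "f u = f v"
      using gx unfolding kernel_def by blast
    obtain s t where g: "s \<in> monoid_semiring B" "t \<in> monoid_semiring B" "g = s - t"
      using monoid_ring_difference[OF gx(1)] by blast
    \<comment> \<open>The product of two differences is written as one difference, since only sums
      can be mapped by \<open>f\<close>.\<close>
    have "f (s * u + t * v) = f (s * v + t * u)"
      using * g by (simp add: f_add f_mult T_mult B_subset_T)
    moreover have "g * x = (s * u + t * v) - (s * v + t * u)" unfolding *(1) g(3) by (simp add: algebra_simps)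
    moreover have "s * u + t * v \<in> monoid_semiring B" "s * v + t * u \<in> monoid_semiring B"
      using * g by (auto intro!: Badd Bmult)
    ultimately show ?thesis unfolding kernel_def by blast
  qed
qed

text \<open>
  Replacing \<open>C\<close> by the monoid of exponents whose monomials lie below a multiple of \<open>1\<close> is what makes
  a relation \<open>s + m = s\<close> of the difference ring descend to \<open>l + m = l\<close> in the semiring itself.
\<close>

lemma of_nat_periodic:
  assumes k: "k \<ge> (1::nat)" and P: "infinite P" "\<And>p. p \<in> P \<Longrightarrow> prime p"
    and dvd: "\<And>p. p \<in> P \<Longrightarrow> \<exists>c\<in>T. f (of_nat k) = f (of_nat p * c)"
  shows "\<exists>l\<ge>1. \<exists>m\<ge>1. f (of_nat (l + m)) = f (of_nat l)"
proof -
  have "\<exists>c\<in>monoid_ring B. of_nat k - of_nat p * c \<in> kernel" if p: "p \<in> P" for p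
  proof -
    obtain c where c: "c \<in> T" "f (of_nat k) = f (of_nat p * c)" using dvd[OF p] by blast
    have p2: "p \<ge> 2" using P(2)[OF p] by (rule prime_ge_2_nat)
    then have pc: "of_nat p * c \<in> T" using c by (intro T_intros) auto
    \<comment> \<open>Adding 1 to both sides supplies the nonzero complement that boundedness asks
      for.\<close>
    then have "f (of_nat p * c + 1) = f (of_nat (k + 1))"
      using c k by (simp add: f_add T_1 T_of_nat add.commute[of 1])
    then have "bounded (of_nat p * c)"
      unfolding bounded_def using pc T_1 by (intro conjI bexI[of _ 1] exI[of _ "k + 1"]) auto
    then have cB: "c \<in> monoid_semiring B" by (rule quotient_of_bounded[OF c(1) p2])
    have natB: "of_nat l \<in> monoid_semiring B" if "l \<ge> 1" for l
      using monoid_semiring_xpow[OF that B_0] by simp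
    have "of_nat p * c \<in> monoid_semiring B"
      using p2 cB by (intro monoid_semiring_mult[OF B_add] natB) auto
    then have "of_nat k - of_nat p * c \<in> kernel"
      unfolding kernel_def using c natB[OF k] by blast
    then show ?thesis using cB by (auto simp: monoid_ring_def monoid_semiring_iff)
  qed
  then obtain m :: nat where m: "m \<ge> 1" "of_nat m \<in> kernel"
    using monoid_ring_ideal_contains_positive_integer[of "{1..n}" B kernel k P]
      B_keys B_0 B_add kernel_ideal k P by blast
  then obtain u v where uv: "of_nat m = u - v" "u \<in> monoid_semiring B" "v \<in> monoid_semiring B" "f u = f v"
    unfolding kernel_def by blast
  obtain g l where g: "g \<in> T" "l \<ge> (1::nat)" "f (v + g) = f (of_nat l)" "v \<in> T"
    using bounded_of_B[OF uv(3)] unfolding bounded_def by blast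
  have u: "u = v + of_nat m" using uv(1) by simp
  \<comment> \<open>The element \<open>g\<close> lifts \<open>v\<close> to the multiple
    \<open>l\<close> of 1. This carries the relation \<open>f (v + of_nat m) = f v\<close> over to
    multiples of 1.\<close>
  have "f (of_nat (l + m)) = f (v + g) + f (of_nat m)"
    using g m by (simp add: f_add T_of_nat)
  also have "\<dots> = f (v + g + of_nat m)" using g m by (simp add: f_add T_of_nat monoid_semiring_add)
  also have "v + g + of_nat m = u + g" by (simp add: u ac_simps)
  also have "f (u + g) = f (v + g)" using uv g by (simp add: f_add B_subset_T)
  finally show ?thesis using g m by auto
qed

end

section \<open>Fractions with prescribed prime denominators\<close>

lemma fractions_mult_of_nat:
  assumes "x \<in> fractions P" "l \<ge> 1"
  shows "of_nat l * x \<in> fractions P"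
proof -
  obtain k Q where "x = of_nat k / of_nat (prod_mset Q)" "k \<ge> 1" "set_mset Q \<subseteq> P"
    using assms(1) unfolding fractions_def by blast
  then show ?thesis
    unfolding fractions_def using assms(2)
    by (intro CollectI exI[of _ "l * k"] exI[of _ Q]) auto
qed

lemma multiple_fractions:
  assumes \<phi>: "semiring_hom_on (fractions P) \<phi>" and x: "x \<in> fractions P" and "l \<ge> 1"
  shows "multiple l (\<phi> x) = \<phi> (of_nat l * x)"
  using assms(3)
proof (induction l rule: dec_induct)
  case (step l)
  then have "\<phi> (x + of_nat l * x) = \<phi> x + \<phi> (of_nat l * x)"
    using \<phi> x fractions_mult_of_nat[OF x, of l] by (simp add: semiring_hom_on_def)
  then show ?case using step by (simp add: multiple_Suc distrib_right)
qed simp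

lemma one_in_fractions: "1 \<in> fractions P"
  unfolding fractions_def by (intro CollectI exI[of _ 1] exI[of _ "{#}"]) auto

lemma inverse_in_fractions: "p \<in> P \<Longrightarrow> 1 / of_nat p \<in> fractions P"
  unfolding fractions_def by (intro CollectI exI[of _ 1] exI[of _ "{#p#}"]) auto

context monoid_semiring_hom
begin

text \<open>The copy of 1 is an idempotent \<open>e\<close> that may differ from \<open>f 1\<close>.
  In the ideal S e it is the unity and is divisible by every \<open>p\<close> in \<open>P\<close>,
  so two of its multiples coincide, against injectivity.\<close>

lemma no_fractions_in_image:
  fixes \<phi> :: "rat \<Rightarrow> 's"
  assumes onto: "f ` T = UNIV" and P: "infinite P" "\<And>p. p \<in> P \<Longrightarrow> prime p"
    and \<phi>: "semiring_hom_on (fractions P) \<phi>"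
  shows "\<not> inj_on \<phi> (fractions P)"
proof
  assume inj: "inj_on \<phi> (fractions P)"
  define e where "e = \<phi> 1"
  have idem: "\<phi> x * e = \<phi> x" if "x \<in> fractions P" for x
    using \<phi> that one_in_fractions[of P] by (metis e_def mult.right_neutral semiring_hom_on_def)
  have ee: "e * e = e" using idem[OF one_in_fractions] by (simp add: e_def)
  obtain e' where e': "e' \<in> T" "f e' = e" using onto by (metis UNIV_I imageE)
  \<comment> \<open>The type \<open>'s\<close> is not assumed commutative; commutativity is
    inherited from polynomials through \<open>f\<close>.\<close>
  have comm: "f x * e = e * f x" if "x \<in> T" for x
    using e' that by (metis f_mult mult.commute)
  \<comment> \<open>Multiplication by the commuting idempotent \<open>e\<close> is a homomorphism
    onto S e, so the composite is again defined on the whole monoid semiring and sends 1 to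
    \<open>e\<close>.\<close>
  interpret fe: monoid_semiring_hom n C "\<lambda>g. f g * e"
  proof
    show "submonoid_of_exponents n C" by (rule C)
    have "f x * f y * e = f x * e * (f y * e)" if "x \<in> T" "y \<in> T" for x y
      by (metis comm ee mult.assoc that(2))
    then show "semiring_hom_on T (\<lambda>g. f g * e)"
      by (simp add: semiring_hom_on_def f_add f_mult distrib_right)
  qed
  have f1: "f 1 * e = e" using f_mult[OF T_1 e'(1)] e' by simp
  have "\<exists>c\<in>T. f (of_nat 1) * e = f (of_nat p * c) * e" if p: "p \<in> P" for p
  proof -
    have p1: "p \<ge> 1" using prime_ge_1_nat P(2)[OF p] by blast
    obtain c where c: "c \<in> T" "f c = \<phi> (1 / of_nat p)" using onto by (metis UNIV_I imageE)
    have "f (of_nat p * c) * e = multiple p (f c * e)" using fe.multiple_f[OF p1 c(1)] by simp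
    also have "\<dots> = multiple p (\<phi> (1 / of_nat p))" using c idem[OF inverse_in_fractions[OF p]] by simp
    also have "\<dots> = \<phi> (of_nat p * (1 / of_nat p))"
      by (rule multiple_fractions[OF \<phi> inverse_in_fractions[OF p] p1])
    also have "\<dots> = e" using p1 by (simp add: e_def)
    finally show ?thesis using c(1) f1 by (intro bexI[of _ c]) simp_all
  qed
  then obtain l m :: nat where lm: "l \<ge> 1" "m \<ge> 1" "f (of_nat (l + m)) * e = f (of_nat l) * e"
    using fe.of_nat_periodic[OF order_refl P] by blast
  have val: "f (of_nat j) * e = \<phi> (of_nat j)" if "j \<ge> 1" for j
    using fe.multiple_f[OF that T_1] multiple_fractions[OF \<phi> one_in_fractions that] f1 by (simp add: e_def)
  have eq: "\<phi> (of_nat (l + m)) = \<phi> (of_nat l)"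
    using val[of "l + m"] val[of l] lm(1) unfolding lm(3) by (metis trans_le_add1)
  have mem: "of_nat j \<in> fractions P" if "j \<ge> 1" for j
    using fractions_mult_of_nat[OF one_in_fractions that] by simp
  have "(of_nat (l + m) :: rat) = of_nat l"
    by (rule inj_onD[OF inj eq mem mem]) (use lm in auto)
  then show False using lm by simp
qed

text \<open>Each \<open>a\<close> is some \<open>f x\<close>, and its multiples are the products
  \<open>f (of_nat j) * f x\<close>. One coincidence between multiples of \<open>f 1\<close>
  therefore gives the same index and period for all elements.\<close>

lemma almost_divisible_one_imp_uniformly_periodic:
  assumes onto: "f ` T = UNIV" and "almost_divisible (f 1)"
  shows "\<exists>l\<ge>1. \<exists>m\<ge>1. \<forall>a::'s. multiple (l + m) a = multiple l a"
proof -
  obtain k P where k: "k \<ge> 1" and P: "infinite P" "\<forall>p\<in>P. prime p" "\<forall>p\<in>P. \<exists>c. multiple k (f 1) = multiple p c"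
    using assms(2) unfolding almost_divisible_def strongly_almost_divisible_def by blast
  have "\<exists>c\<in>T. f (of_nat k) = f (of_nat p * c)" if p: "p \<in> P" for p
  proof -
    obtain c where c: "multiple k (f 1) = multiple p c" using P(3) p by blast
    obtain c' where "c' \<in> T" "c = f c'" using onto by (metis UNIV_I imageE)
    then show ?thesis using c multiple_f[OF k T_1] multiple_f[of p c'] P(2) p prime_ge_1_nat by auto
  qed
  then obtain l m where lm: "l \<ge> 1" "m \<ge> 1" "f (of_nat (l + m)) = f (of_nat l)"
    using of_nat_periodic[OF k P(1)] P(2) by blast
  have "multiple (l + m) a = multiple l a" for a :: 's
  proof -
    obtain x where x: "x \<in> T" "a = f x" using onto by (metis UNIV_I imageE)
    have "multiple j a = f (of_nat j) * f x" if "j \<ge> 1" for j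
      using multiple_f[OF that x(1)] f_mult[OF T_of_nat[OF that] x(1)] x(2) by simp
    then show ?thesis using lm by simp
  qed
  then show ?thesis using lm by blast
qed

end

theorem theorem5p4:
  fixes n :: nat
    and C :: "(nat \<Rightarrow>\<^sub>0 nat) set"
    and f :: "((nat \<Rightarrow>\<^sub>0 nat) \<Rightarrow>\<^sub>0 int) \<Rightarrow> 's::semiring"
  assumes "n \<ge> 1"
    and "submonoid_of_exponents n C"
    and "semiring_hom_on (monoid_semiring C) f"
    and "f ` monoid_semiring C = (UNIV :: 's set)"
  shows "((\<forall>a::'s. almost_divisible a) \<longleftrightarrow> (\<forall>a::'s. torsion a)) \<and>
    ((\<forall>a::'s. strongly_almost_divisible a) \<longleftrightarrow>
       (\<forall>a::'s. regular a) \<and> (\<forall>a::'s. torsion a)) \<and>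
    (\<forall>P :: nat set. infinite P \<and> (\<forall>p\<in>P. prime p) \<longrightarrow>
       \<not> (\<exists>\<phi> :: rat \<Rightarrow> 's. semiring_hom_on (fractions P) \<phi> \<and> inj_on \<phi> (fractions P)))"
proof -
  interpret monoid_semiring_hom n C f by unfold_locales (fact assms)+
  \<comment> \<open>Having one pair \<open>l\<close>, \<open>m\<close> for all elements gives
    torsion in both equivalences, and its uniformity gives regularity in the second.\<close>
  have periodic: "\<exists>l\<ge>1. \<exists>m\<ge>1. \<forall>a::'s. multiple (l + m) a = multiple l a"
    if "\<forall>a::'s. almost_divisible a"
    using almost_divisible_one_imp_uniformly_periodic[OF assms(4)] that by blast
  show ?thesis
  proof (intro conjI iffI allI impI)
    show "torsion a" if "\<forall>a::'s. almost_divisible a" for a :: 's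
      using periodic[OF that] unfolding torsion_iff by blast
    show "almost_divisible a" if "\<forall>a::'s. torsion a" for a :: 's
      using that torsion_imp_almost_divisible by blast
    show "torsion a" if "\<forall>a::'s. strongly_almost_divisible a" for a :: 's
      using periodic that strongly_almost_divisible_imp_almost_divisible unfolding torsion_iff by blast
    show "regular a" if all: "\<forall>a::'s. strongly_almost_divisible a" for a :: 's
    proof -
      obtain l m where "l \<ge> 1" "m \<ge> 1" "\<And>a::'s. multiple (l + m) a = multiple l a"
        using periodic all strongly_almost_divisible_imp_almost_divisible by metis
      then show ?thesis using uniformly_periodic_imp_regular all by blast
    qed
    show "strongly_almost_divisible a" if "(\<forall>a::'s. regular a) \<and> (\<forall>a::'s. torsion a)" for a :: 's
      using that regular_torsion_imp_strongly_almost_divisible by blast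
    show "\<not> (\<exists>\<phi> :: rat \<Rightarrow> 's. semiring_hom_on (fractions P) \<phi> \<and> inj_on \<phi> (fractions P))"
      if "infinite P \<and> (\<forall>p\<in>P. prime p)" for P :: "nat set"
      using no_fractions_in_image[OF assms(4)] that by blast
  qed
qed

end
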